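(* Let $k$ be an algebraically closed field of characteristic $p>0$, and let $f\in k[x]$ be a separable additive or subadditive polynomial (viewed as a self-map of $\mathbb{P}^1(k)$). If $f'(0)$ is algebraic over $\mathbb{F}_p$, then $\zeta(f,\mathbb{P}^1(k);t)$ is transcendental over $\mathbb{Q}(t)$. If $f'(0)$ is transcendental over $\mathbb{F}_p$, then $\zeta(f,\mathbb{P}^1(k);t)$ is rational, i.e. lies in $\mathbb{Q}(t)$.
   Context: For a map $f:X\to X$, $\mathrm{Per}_n(f)=\{x\in X: f^n(x)=x\}$, and the Artin–Mazur zeta function is $\zeta(f,X;t)=\exp\left(\sum_{n\ge1}\#\mathrm{Per}_n(f)\frac{t^n}{n}\right)\in\mathbb{Q}[[t]]$. A polynomial is separable if its derivative is not identically zero. An additive polynomial (endomorphism of $\mathbb{G}_a$) is a polynomial of the form $\sigma(x)=\sum_{i=0}^r a_i x^{p^i}$ with $a_i\in k$. An additive polynomial map here means $f(x)=\sigma(x)+c$ with $\sigma$ additive of degree at least $2$ and $c\in k$. A subadditive polynomial is an $f\in k[x]$ for which there exist an integer $d\ge 2$ with $p\nmid d$ and an additive polynomial $\psi$ of degree at least $2$ satisfying $\psi(\omega x)=\omega\psi(x)$ for a primitive $d$th root of unity $\omega$, such that $f(x^d)=\psi(x)^d$. *)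

theory Defs
  imports "HOL-Computational_Algebra.Computational_Algebra"
begin

definition Per :: "('x \<Rightarrow> 'x) \<Rightarrow> 'x set \<Rightarrow> nat \<Rightarrow> 'x set" where
  "Per f X n = {x \<in> X. (f ^^ n) x = x}"

text \<open>
  The Artin--Mazur zeta function makes sense only if every \<^term>\<open>Per f X n\<close> with \<open>n \<ge> 1\<close>
  is finite, as is the case for a polynomial map of degree at least 2 on the projective line.
\<close>

definition artin_mazur_zeta :: "('x \<Rightarrow> 'x) \<Rightarrow> 'x set \<Rightarrow> rat fps" where
  "artin_mazur_zeta f X =
     fps_exp 1 oo Abs_fps (\<lambda>n. if n = 0 then 0 else of_nat (card (Per f X n)) / of_nat n)"

datatype 'a proj_line = Finite 'a | Infinity

text \<open>
  The self-map of \<open>\<bbbP>\<^sup>1(k) = k \<union> {\<infinity>}\<close> given by a polynomial: a nonconstant polynomial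
  fixes \<open>\<infinity>\<close>, a constant one maps \<open>\<infinity>\<close> to its value.
\<close>

fun proj_map :: "'a::field poly \<Rightarrow> 'a proj_line \<Rightarrow> 'a proj_line" where
  "proj_map f (Finite x) = Finite (poly f x)"
| "proj_map f Infinity = (if degree f = 0 then Finite (coeff f 0) else Infinity)"

definition separable :: "'a::field poly \<Rightarrow> bool" where
  "separable f \<longleftrightarrow> pderiv f \<noteq> 0"

definition additive_poly :: "'a::field poly \<Rightarrow> bool" where
  "additive_poly \<sigma> \<longleftrightarrow> (\<exists>r a. \<sigma> = (\<Sum>i\<le>r. monom (a i) (CHAR('a) ^ i)))"

text \<open>
  Additive polynomial \<^emph>\<open>maps\<close> may have a constant term, unlike additive polynomials proper,
  which are the endomorphisms of the additive group.
\<close>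

definition additive_poly_map :: "'a::field poly \<Rightarrow> bool" where
  "additive_poly_map f \<longleftrightarrow> (\<exists>\<sigma> c. additive_poly \<sigma> \<and> degree \<sigma> \<ge> 2 \<and> f = \<sigma> + [:c:])"

definition primitive_root_of_unity :: "nat \<Rightarrow> 'a::field \<Rightarrow> bool" where
  "primitive_root_of_unity d \<omega> \<longleftrightarrow> \<omega> ^ d = 1 \<and> (\<forall>j. 0 < j \<and> j < d \<longrightarrow> \<omega> ^ j \<noteq> 1)"

definition subadditive_poly :: "'a::field poly \<Rightarrow> bool" where
  "subadditive_poly f \<longleftrightarrow>
     (\<exists>d \<psi> \<omega>. d \<ge> 2 \<and> \<not> CHAR('a) dvd d \<and>
        additive_poly \<psi> \<and> degree \<psi> \<ge> 2 \<and>
        primitive_root_of_unity d \<omega> \<and>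
        pcompose \<psi> [:0, \<omega>:] = smult \<omega> \<psi> \<and>
        pcompose f (monom 1 d) = \<psi> ^ d)"

text \<open>In both notions below, \<open>K\<close> is meant to be a subfield of the ambient type.\<close>

definition algebraic_over :: "'a::field set \<Rightarrow> 'a \<Rightarrow> bool" where
  "algebraic_over K x \<longleftrightarrow> (\<exists>P. P \<noteq> 0 \<and> (\<forall>i. coeff P i \<in> K) \<and> poly P x = 0)"

definition transcendental_over :: "'a::field set \<Rightarrow> 'a \<Rightarrow> bool" where
  "transcendental_over K x \<longleftrightarrow> \<not> algebraic_over K x"

text \<open>
  In a field of positive characteristic \<open>p\<close>, the image of the integers is the prime field
  \<open>\<bbbF>\<^sub>p\<close>. (In characteristic 0 it would not be a field.)
\<close>

definition prime_field :: "'a::field set" where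
  "prime_field = range of_int"

text \<open>The field \<open>\<rat>(t)\<close>, realised inside the field \<open>\<rat>((t))\<close> of formal Laurent series.\<close>

definition rational_functions :: "rat fls set" where
  "rational_functions =
     {fps_to_fls (fps_of_poly P) / fps_to_fls (fps_of_poly Q) | P Q. Q \<noteq> 0}"

end

theory Submission
  imports Defs
begin

text \<open>
  Up to a translation (additive case) or the substitution \<open>x\<^sup>d\<close> (subadditive case), fixed points
  of \<open>f\<^sup>n\<close> are solutions of \<open>\<psi>\<^sup>n(x) = c x\<close> with \<open>\<psi>\<close> additive and \<open>c\<^sup>d = 1\<close>; since
  additive polynomials have all roots of the same multiplicity, the number of solutions
  is \<open>deg(\<psi>)\<^sup>n\<close> divided by the order of vanishing of \<open>\<psi>\<^sup>n - c x\<close> at 0. Put \<open>b = f'(0)\<close>. If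
  \<open>b\<close> is not a root of unity, these orders are 1 and the zeta function is
  \<open>1 / ((1 - t) (1 - deg(\<psi>) t))\<close>. If \<open>b\<close> has order \<open>m\<close>, then, by the binomial theorem in
  characteristic \<open>p\<close>, the order for \<open>n = m s\<close> and the one relevant \<open>c\<close> is \<open>W\<close> to the power
  \<open>p\<close> to the power \<open>v\<^sub>p(s)\<close>, for some \<open>W \<ge> 2\<close>.

  An algebraic zeta function would have a logarithmic derivative that is algebraic. All
  derivatives of an algebraic series lie in one finite extension of \<open>\<rat>(t)\<close>, so it satisfies a
  linear differential equation over \<open>\<rat>(t)\<close>, and the point counts would satisfy a linear recurrence
  with polynomial coefficients. They do not: the dependence on \<open>v\<^sub>p(s)\<close> is too irregular.
\<close>

section \<open>Differential extensions generated by an algebraic element\<close>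

locale subfield_set =
  fixes S :: "'a::field set"
  assumes one_mem: "1 \<in> S"
    and diff_mem: "x \<in> S \<Longrightarrow> y \<in> S \<Longrightarrow> x - y \<in> S"
    and mult_mem: "x \<in> S \<Longrightarrow> y \<in> S \<Longrightarrow> x * y \<in> S"
    and inverse_mem: "x \<in> S \<Longrightarrow> inverse x \<in> S"
begin

lemma zero_mem: "0 \<in> S"
  using diff_mem[OF one_mem one_mem] by simp

lemma uminus_mem: "x \<in> S \<Longrightarrow> - x \<in> S"
  using diff_mem[OF zero_mem] by force

lemma add_mem: "x \<in> S \<Longrightarrow> y \<in> S \<Longrightarrow> x + y \<in> S"
  using diff_mem[OF _ uminus_mem, of x y] by simp

lemma divide_mem: "x \<in> S \<Longrightarrow> y \<in> S \<Longrightarrow> x / y \<in> S"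
  by (simp add: divide_inverse mult_mem inverse_mem)

lemma of_nat_mem: "of_nat n \<in> S"
  by (induction n) (auto intro: zero_mem one_mem add_mem)

lemma sum_mem: "(\<And>x. x \<in> J \<Longrightarrow> g x \<in> S) \<Longrightarrow> sum g J \<in> S"
  by (induction J rule: infinite_finite_induct) (auto intro: zero_mem add_mem)

lemmas mems = zero_mem one_mem add_mem diff_mem uminus_mem mult_mem divide_mem of_nat_mem inverse_mem

section \<open>Linear spans over a subfield\<close>

definition fspan :: "(nat \<Rightarrow> 'a) \<Rightarrow> nat \<Rightarrow> 'a set" where
  "fspan e n = {v. \<exists>c. (\<forall>i. c i \<in> S) \<and> v = (\<Sum>i<n. c i * e i)}"

lemma fspanI: "(\<And>i. c i \<in> S) \<Longrightarrow> v = (\<Sum>i<n. c i * e i) \<Longrightarrow> v \<in> fspan e n"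
  by (auto simp: fspan_def)

lemma fspanE:
  assumes "v \<in> fspan e n"
  obtains c where "\<And>i. c i \<in> S" "v = (\<Sum>i<n. c i * e i)"
  using assms by (auto simp: fspan_def)

lemma fspan_zero: "0 \<in> fspan e n"
  by (rule fspanI[of "\<lambda>_. 0"]) (auto intro: mems)

lemma fspan_base: "i < n \<Longrightarrow> e i \<in> fspan e n"
  by (rule fspanI[of "\<lambda>j. if j = i then 1 else 0"]) (auto intro: zero_mem one_mem simp: mult_delta_left)

lemma fspan_add:
  assumes "v \<in> fspan e n" "w \<in> fspan e n"
  shows "v + w \<in> fspan e n"
proof -
  from assms obtain c d where "\<And>i. c i \<in> S" "v = (\<Sum>i<n. c i * e i)"
    "\<And>i. d i \<in> S" "w = (\<Sum>i<n. d i * e i)"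
    by (metis fspanE)
  then show ?thesis
    by (intro fspanI[of "\<lambda>i. c i + d i"]) (auto intro: mems simp: sum.distrib algebra_simps)
qed

lemma fspan_scale:
  assumes "v \<in> fspan e n" "s \<in> S"
  shows "s * v \<in> fspan e n"
proof -
  from assms obtain c where "\<And>i. c i \<in> S" "v = (\<Sum>i<n. c i * e i)"
    by (metis fspanE)
  then show ?thesis using assms
    by (intro fspanI[of "\<lambda>i. s * c i"]) (auto intro: mems simp: sum_distrib_left algebra_simps)
qed

lemma fspan_sum: "(\<And>x. x \<in> J \<Longrightarrow> g x \<in> fspan e n) \<Longrightarrow> sum g J \<in> fspan e n"
  by (induction J rule: infinite_finite_induct) (auto intro: fspan_zero fspan_add)

text \<open>Gaussian elimination on the last coordinate: a pivot \<open>v k\<close> with nonzero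
  coefficient there clears it from the other vectors, which then lie in a span of one generator
  less. Indexing by \<open>J\<close> instead of taking a set of vectors lets repetitions count as
  dependencies.\<close>

lemma fspan_dependent:
  assumes "finite J" "card J > n" "\<And>j. j \<in> J \<Longrightarrow> v j \<in> fspan e n"
  shows "\<exists>c. (\<forall>j. c j \<in> S) \<and> (\<exists>j\<in>J. c j \<noteq> 0) \<and> (\<Sum>j\<in>J. c j * v j) = 0"
  using assms
proof (induction n arbitrary: J v)
  case 0
  then have "J \<noteq> {}" "\<And>j. j \<in> J \<Longrightarrow> v j = 0"
    by (auto simp: fspan_def)
  then show ?case by (intro exI[of _ "\<lambda>_. 1"]) (auto simp: one_mem)
next
  case (Suc n)
  have "\<forall>j\<in>J. \<exists>c. (\<forall>i. c i \<in> S) \<and> v j = (\<Sum>i<Suc n. c i * e i)"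
    using Suc.prems(3) by (auto simp: fspan_def)
  from bchoice[OF this] obtain a where a: "\<And>j i. j \<in> J \<Longrightarrow> a j i \<in> S"
      "\<And>j. j \<in> J \<Longrightarrow> v j = (\<Sum>i<Suc n. a j i * e i)"
    by blast
  show ?case
  proof (cases "\<forall>j\<in>J. a j n = 0")
    case True
    have "v j \<in> fspan e n" if "j \<in> J" for j
      using a(1)[OF that] a(2)[OF that] True that by (intro fspanI[of "a j"]) auto
    then show ?thesis using Suc.IH[of J v] Suc.prems by simp
  next
    case False
    then obtain k where k: "k \<in> J" "a k n \<noteq> 0" by auto
    define v' where "v' = (\<lambda>j. v j - a j n / a k n * v k)"
    have "v' j \<in> fspan e n" if j: "j \<in> J - {k}" for j
    proof -
      let ?c = "\<lambda>i. a j i - a j n / a k n * a k i"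
      have "v' j = (\<Sum>i<Suc n. ?c i * e i)"
        using j k unfolding v'_def
        by (simp only: a(2) Diff_iff left_diff_distrib sum_subtractf sum_distrib_left mult.assoc)
      also have "\<dots> = (\<Sum>i<n. ?c i * e i)"
        using k by simp
      finally show ?thesis
        using j k a(1) by (intro fspanI[of ?c] diff_mem mult_mem divide_mem) auto
    qed
    moreover have "finite (J - {k})" "card (J - {k}) > n"
      using Suc.prems(1,2) k(1) by auto
    ultimately obtain c where c: "\<And>j. c j \<in> S" "\<exists>j\<in>J-{k}. c j \<noteq> 0" "(\<Sum>j\<in>J-{k}. c j * v' j) = 0"
      using Suc.IH[of "J - {k}" v'] by blast
    \<comment> \<open>The multiples of \<open>v k\<close> hidden in the vectors \<open>v' j\<close>
      add up to \<open>s\<close>, so \<open>- s\<close> becomes the coefficient at the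
      pivot.\<close>
    define s where "s = (\<Sum>j\<in>J-{k}. c j * (a j n / a k n))"
    have s: "s \<in> S" unfolding s_def by (intro sum_mem mult_mem divide_mem c(1) a(1)) (use k in auto)
    let ?c = "c(k := - s)"
    have "(\<Sum>j\<in>J. ?c j * v j) = - s * v k + (\<Sum>j\<in>J-{k}. ?c j * v j)"
      using k Suc.prems(1) by (simp add: sum.remove)
    also have "(\<Sum>j\<in>J-{k}. ?c j * v j) = (\<Sum>j\<in>J-{k}. c j * v j)"
      by (intro sum.cong) auto
    also have "- s * v k + \<dots> = (\<Sum>j\<in>J-{k}. c j * v' j)"
      by (simp add: v'_def s_def algebra_simps sum_subtractf sum_distrib_left)
    finally have "(\<Sum>j\<in>J. ?c j * v j) = 0" using c by simp
    moreover have "\<exists>j\<in>J. ?c j \<noteq> 0" using c(2) by auto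
    ultimately show ?thesis using uminus_mem[OF s] c(1) by (intro exI[of _ ?c]) auto
  qed
qed

section \<open>The extension generated by one algebraic element\<close>

context
  fixes y :: 'a and P :: "'a poly"
  assumes P: "\<And>i. coeff P i \<in> S" "P \<noteq> 0" "poly P y = 0"
begin

abbreviation "powspan \<equiv> fspan (\<lambda>i. y ^ i) (degree P)"

lemma degree_annihilator_pos: "degree P > 0"
  using P(2,3) by (metis degree_eq_zeroE neq0_conv pCons_0_0 poly_const_conv)

lemma powspan_scalar: "s \<in> S \<Longrightarrow> s \<in> powspan"
  using fspan_scale[OF fspan_base[of 0 "degree P" "\<lambda>i. y ^ i"], of s] degree_annihilator_pos by simp

lemma powspan_top: "y ^ degree P \<in> powspan"
proof -
  let ?n = "degree P"
  have "(\<Sum>i<?n. coeff P i * y ^ i) + lead_coeff P * y ^ ?n = 0"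
    using P(3) by (simp add: poly_altdef flip: lessThan_Suc_atMost)
  then have "y ^ ?n = - (\<Sum>i<?n. coeff P i * y ^ i) / lead_coeff P"
    using P(2) by (simp add: field_simps eq_neg_iff_add_eq_0)
  also have "\<dots> = (\<Sum>i<?n. (- coeff P i / lead_coeff P) * y ^ i)"
    by (simp add: sum_negf sum_divide_distrib)
  finally have "y ^ ?n = (\<Sum>i<?n. (- coeff P i / lead_coeff P) * y ^ i)" .
  then show ?thesis using P(1) by (intro fspanI[of "\<lambda>i. - coeff P i / lead_coeff P"]) (auto intro: mems)
qed

lemma powspan_mult_gen:
  assumes "v \<in> powspan"
  shows "y * v \<in> powspan"
proof -
  obtain c where c: "\<And>i. c i \<in> S" "v = (\<Sum>i<degree P. c i * y ^ i)"
    using assms by (metis fspanE)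
  have "y * v = (\<Sum>i<degree P. c i * y ^ Suc i)"
    by (simp add: c(2) sum_distrib_left algebra_simps)
  also have "\<dots> \<in> powspan"
  proof (intro fspan_sum fspan_scale c(1))
    fix i assume "i \<in> {..<degree P}"
    then consider "Suc i < degree P" | "Suc i = degree P" by fastforce
    then show "y ^ Suc i \<in> powspan"
      using powspan_top fspan_base[of "Suc i" "degree P" "\<lambda>i. y ^ i"] by cases simp_all
  qed
  finally show ?thesis .
qed

lemma powspan_mult:
  assumes "v \<in> powspan" "w \<in> powspan"
  shows "v * w \<in> powspan"
proof -
  obtain c where c: "\<And>i. c i \<in> S" "v = (\<Sum>i<degree P. c i * y ^ i)"
    using assms by (metis fspanE)
  have "y ^ i * w \<in> powspan" for i
    by (induction i) (use assms in \<open>auto dest: powspan_mult_gen simp: mult.assoc\<close>)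
  then have "(\<Sum>i<degree P. c i * (y ^ i * w)) \<in> powspan"
    by (intro fspan_sum fspan_scale[OF _ c(1)])
  then show ?thesis by (simp add: c(2) sum_distrib_right mult.assoc)
qed

lemma powspan_power: "v \<in> powspan \<Longrightarrow> v ^ i \<in> powspan"
  by (induction i) (auto intro: powspan_mult powspan_scalar one_mem)

lemma powspan_poly: "(\<And>i. coeff Q i \<in> powspan) \<Longrightarrow> v \<in> powspan \<Longrightarrow> poly Q v \<in> powspan"
  unfolding poly_altdef by (intro fspan_sum powspan_mult powspan_power)

lemma gen_mem_powspan: "y \<in> powspan"
  using powspan_mult_gen[OF powspan_scalar[OF one_mem]] by simp

text \<open>The powers of \<open>x\<close> with exponents 0 to \<open>degree P\<close> are one more
  than the number of generators, hence satisfy a linear relation. Dividing it by the lowest power of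
  \<open>x\<close> that occurs leaves a nonzero constant term, which expresses the inverse as a
  polynomial in \<open>x\<close>.\<close>

lemma powspan_inverse:
  assumes "x \<in> powspan"
  shows "inverse x \<in> powspan"
proof (cases "x = 0")
  case False
  obtain c where c: "\<And>j. c j \<in> S" "\<exists>j\<in>{..degree P}. c j \<noteq> 0" "(\<Sum>j\<le>degree P. c j * x ^ j) = 0"
    using fspan_dependent[of "{..degree P}" "degree P" "\<lambda>j. x ^ j" "\<lambda>i. y ^ i"] powspan_power[OF assms] by auto
  define k where "k = (LEAST j. j \<le> degree P \<and> c j \<noteq> 0)"
  have k: "k \<le> degree P" "c k \<noteq> 0"
    using LeastI_ex[of "\<lambda>j. j \<le> degree P \<and> c j \<noteq> 0"] c(2) by (auto simp: k_def)
  have less: "c j = 0" if "j < k" for j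
    using not_less_Least[of j "\<lambda>j. j \<le> degree P \<and> c j \<noteq> 0"] that k by (auto simp: k_def)
  have "0 = (\<Sum>j=k..degree P. c j * x ^ j)"
    using c(3) less by (subst c(3)[symmetric], intro sum.mono_neutral_right) auto
  also have "\<dots> = c k * x ^ k + (\<Sum>j=Suc k..degree P. c j * x ^ j)"
    using k(1) by (simp add: sum.atLeast_Suc_atMost)
  also have "(\<Sum>j=Suc k..degree P. c j * x ^ j) = x ^ k * (x * (\<Sum>j=Suc k..degree P. c j * x ^ (j - Suc k)))"
    unfolding sum_distrib_left
  proof (intro sum.cong refl)
    fix j assume "j \<in> {Suc k..degree P}"
    then have "j = k + Suc (j - Suc k)" by simp
    then have "x ^ j = x ^ k * (x * x ^ (j - Suc k))"
      by (metis power_add power_Suc)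
    then show "c j * x ^ j = x ^ k * (x * (c j * x ^ (j - Suc k)))" by simp
  qed
  finally have "x ^ k * (c k + x * (\<Sum>j=Suc k..degree P. c j * x ^ (j - Suc k))) = 0"
    by (simp add: algebra_simps)
  then have "c k + x * (\<Sum>j=Suc k..degree P. c j * x ^ (j - Suc k)) = 0"
    using False by simp
  then have "inverse x = (- inverse (c k)) * (\<Sum>j=Suc k..degree P. c j * x ^ (j - Suc k))"
    using False k(2) by (simp add: field_simps eq_neg_iff_add_eq_0)
  also have "\<dots> \<in> powspan"
    by (intro fspan_scale fspan_sum powspan_power assms mems c(1))
  finally show ?thesis .
qed (simp add: fspan_zero)

end

lemma minimal_annihilator:
  assumes "algebraic_over S y"
  obtains P where "\<And>i. coeff P i \<in> S" "P \<noteq> 0" "poly P y = 0"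
    "\<And>Q. (\<And>i. coeff Q i \<in> S) \<Longrightarrow> Q \<noteq> 0 \<Longrightarrow> degree Q < degree P \<Longrightarrow> poly Q y \<noteq> 0"
proof -
  let ?A = "\<lambda>P. (\<forall>i. coeff P i \<in> S) \<and> P \<noteq> 0 \<and> poly P y = 0"
  have "\<exists>P. ?A P" using assms by (auto simp: algebraic_over_def)
  then obtain P where "?A P" "\<And>Q. ?A Q \<Longrightarrow> degree P \<le> degree Q"
    using ex_has_least_nat[of ?A _ degree] by blast
  then show ?thesis using that[of P] by (metis linorder_not_less)
qed

end

section \<open>Derivations and linear differential equations\<close>

locale derivation_subfield = subfield_set S for S :: "'a::field_char_0 set" +
  fixes D :: "'a \<Rightarrow> 'a"
  assumes D_add: "D (x + y) = D x + D y"
    and D_mult: "D (x * y) = D x * y + x * D y"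
    and D_mem: "x \<in> S \<Longrightarrow> D x \<in> S"
begin

lemma D_zero [simp]: "D 0 = 0"
  using D_add[of 0 0] by simp

lemma D_sum: "D (sum g J) = (\<Sum>x\<in>J. D (g x))"
  by (induction J rule: infinite_finite_induct) (auto simp: D_add)

lemma D_power: "D (x ^ n) = of_nat n * x ^ (n - 1) * D x"
proof (induction n)
  case 0
  show ?case using D_mult[of 1 1] by simp
next
  case (Suc n)
  then show ?case by (cases n) (simp_all add: D_mult algebra_simps)
qed

lemma D_poly: "D (poly Q x) = poly (map_poly D Q) x + poly (pderiv Q) x * D x"
proof (induction Q)
  case (pCons a Q)
  then show ?case by (simp add: map_poly_pCons D_add D_mult pderiv_pCons algebra_simps)
qed simp

text \<open>
  The extension generated by an algebraic element is closed under the derivation: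
  differentiating \<open>P(y) = 0\<close> for the minimal \<open>P\<close> expresses \<open>D y\<close> through \<open>y\<close>.
\<close>

lemma algebraic_imp_differential_extension:
  assumes "algebraic_over S y"
  obtains V e n where "V = fspan e n" "S \<subseteq> V" "y \<in> V"
    "\<And>v w. v \<in> V \<Longrightarrow> w \<in> V \<Longrightarrow> v * w \<in> V"
    "\<And>v. v \<in> V \<Longrightarrow> inverse v \<in> V"
    "\<And>v. v \<in> V \<Longrightarrow> D v \<in> V"
proof -
  obtain P where P: "\<And>i. coeff P i \<in> S" "P \<noteq> 0" "poly P y = 0"
    and least: "\<And>Q. (\<And>i. coeff Q i \<in> S) \<Longrightarrow> Q \<noteq> 0 \<Longrightarrow> degree Q < degree P \<Longrightarrow> poly Q y \<noteq> 0"
    using minimal_annihilator[OF assms] by metis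
  let ?V = "fspan (\<lambda>i. y ^ i) (degree P)"
  have pos: "degree P > 0" by (rule degree_annihilator_pos[OF P])
  \<comment> \<open>In characteristic 0 the derivative of the nonconstant \<open>P\<close> is
    nonzero, and it has smaller degree than the minimal \<open>P\<close>.\<close>
  have nz: "poly (pderiv P) y \<noteq> 0"
    using pos P(1) by (intro least) (auto simp: coeff_pderiv degree_pderiv pderiv_eq_0_iff of_nat_mem mult_mem simp del: of_nat_Suc)
  have "poly (map_poly D P) y + poly (pderiv P) y * D y = 0"
    using D_poly[of P y] P(3) by simp
  then have "D y = - poly (map_poly D P) y * inverse (poly (pderiv P) y)"
    using nz by (simp add: field_simps eq_neg_iff_add_eq_0)
  moreover have "poly (map_poly D P) y \<in> ?V" "poly (pderiv P) y \<in> ?V"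
    by (rule powspan_poly[OF P]; simp add: coeff_map_poly coeff_pderiv D_mem P(1) mult_mem of_nat_mem
        powspan_scalar[OF P] gen_mem_powspan[OF P] del: of_nat_Suc)+
  ultimately have Dy: "D y \<in> ?V"
    using fspan_scale[of "poly (map_poly D P) y" _ _ "- 1", OF _ uminus_mem[OF one_mem]]
    by (simp add: powspan_inverse[OF P] powspan_mult[OF P] del: mult_minus_left)
  have "D v \<in> ?V" if v: "v \<in> ?V" for v
  proof -
    obtain c where c: "\<And>i. c i \<in> S" "v = (\<Sum>i<degree P. c i * y ^ i)"
      using v by (metis fspanE)
    have "D v = (\<Sum>i<degree P. D (c i) * y ^ i + c i * (of_nat i * (y ^ (i - 1) * D y)))"
      by (simp add: c(2) D_sum D_mult D_power mult.assoc)
    also have "\<dots> \<in> ?V"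
      by (intro fspan_sum fspan_add fspan_scale[OF _ c(1)] fspan_scale[OF _ of_nat_mem] powspan_mult[OF P]
          powspan_power[OF P] powspan_scalar[OF P] gen_mem_powspan[OF P] D_mem c(1) Dy)
    finally show ?thesis .
  qed
  then show ?thesis
    using that[OF refl subsetI[OF powspan_scalar[OF P]] gen_mem_powspan[OF P]
        powspan_mult[OF P] powspan_inverse[OF P]] by blast
qed

text \<open>The logarithmic derivative and all its derivatives stay in one space \<open>V\<close>
  with \<open>n\<close> generators over \<open>S\<close>, so \<open>n + 1\<close> of them are
  dependent. The shift by \<open>s\<close> serves to strip a rational summand from the logarithmic
  derivative.\<close>

lemma algebraic_imp_linear_ode:
  assumes "algebraic_over S y" "s \<in> S"
  shows "\<exists>n c. (\<forall>j. c j \<in> S) \<and> (\<exists>j\<le>n. c j \<noteq> 0) \<and> (\<Sum>j\<le>n. c j * (D ^^ j) (D y / y - s)) = 0"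
proof -
  obtain V e n where V: "V = fspan e n" "S \<subseteq> V" "y \<in> V"
    "\<And>v w. v \<in> V \<Longrightarrow> w \<in> V \<Longrightarrow> v * w \<in> V"
    "\<And>v. v \<in> V \<Longrightarrow> inverse v \<in> V"
    "\<And>v. v \<in> V \<Longrightarrow> D v \<in> V"
    using algebraic_imp_differential_extension[OF assms(1)] by metis
  have "D y * inverse y + - s \<in> V"
    unfolding V(1) by (intro fspan_add) (use V assms(2) uminus_mem in auto)
  then have "D y / y - s \<in> V" by (simp add: divide_inverse)
  then have "(D ^^ j) (D y / y - s) \<in> V" for j
    by (induction j) (auto intro: V(6))
  then have "\<exists>c. (\<forall>j. c j \<in> S) \<and> (\<exists>j\<in>{..n}. c j \<noteq> 0) \<and> (\<Sum>j\<le>n. c j * (D ^^ j) (D y / y - s)) = 0"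
    unfolding V(1) by (intro fspan_dependent[where e = e and n = n]) auto
  then show ?thesis unfolding Bex_def atMost_iff by (rule exI)
qed

end

section \<open>P-recursive sequences\<close>

abbreviation fls_of_poly :: "rat poly \<Rightarrow> rat fls" where
  "fls_of_poly P \<equiv> fps_to_fls (fps_of_poly P)"

lemma fls_of_poly_eq_0_iff: "fls_of_poly P = 0 \<longleftrightarrow> P = 0"
  using fps_of_poly_eq_iff[of P 0] by simp

lemma rational_functionsI: "Q \<noteq> 0 \<Longrightarrow> r = fls_of_poly P / fls_of_poly Q \<Longrightarrow> r \<in> rational_functions"
  by (auto simp: rational_functions_def)

lemma rational_functionsE:
  assumes "r \<in> rational_functions"
  obtains P Q where "Q \<noteq> 0" "r * fls_of_poly Q = fls_of_poly P"
  using assms by (auto simp: rational_functions_def fls_of_poly_eq_0_iff)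

lemma rational_functionsI':
  assumes "Q \<noteq> 0" "r * fls_of_poly Q = fls_of_poly P"
  shows "r \<in> rational_functions"
  by (rule rational_functionsI[of Q _ P]) (use assms in \<open>auto simp: field_simps fls_of_poly_eq_0_iff\<close>)

lemma fls_of_poly_mem: "fls_of_poly P \<in> rational_functions"
  by (rule rational_functionsI'[of 1 _ P]) auto

lemma subfield_rational_functions: "subfield_set rational_functions"
proof
  fix x y assume xy: "x \<in> rational_functions" "y \<in> rational_functions"
  then obtain A B C E where *: "B \<noteq> 0" "x * fls_of_poly B = fls_of_poly A"
      "E \<noteq> 0" "y * fls_of_poly E = fls_of_poly C"
    by (metis rational_functionsE)
  have "(x - y) * fls_of_poly (B * E) = fls_of_poly (A * E - C * B)"
    by (simp add: fps_of_poly_mult fps_of_poly_diff fls_times_fps_to_fls algebra_simps flip: *)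
  then show "x - y \<in> rational_functions"
    by (rule rational_functionsI'[rotated]) (use * in auto)
  have "(x * y) * fls_of_poly (B * E) = fls_of_poly (A * C)"
    by (simp add: fps_of_poly_mult fls_times_fps_to_fls algebra_simps flip: *)
  then show "x * y \<in> rational_functions"
    by (rule rational_functionsI'[rotated]) (use * in auto)
next
  fix x assume "x \<in> rational_functions"
  then obtain A B where *: "B \<noteq> 0" "x * fls_of_poly B = fls_of_poly A"
    by (metis rational_functionsE)
  show "inverse x \<in> rational_functions"
  proof (cases "x = 0")
    case True
    then show ?thesis using fls_of_poly_mem[of 0] by simp
  next
    case False
    then have "A \<noteq> 0" using * fls_of_poly_eq_0_iff by (metis mult_eq_0_iff)
    moreover have "inverse x * fls_of_poly A = fls_of_poly B"
      using False by (simp add: field_simps flip: *)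
    ultimately show ?thesis by (rule rational_functionsI')
  qed
qed (use fls_of_poly_mem[of 1] in simp)

text \<open>The derivation is \<open>t d/dt\<close> because it multiplies the \<open>n\<close>-th
  coefficient by \<open>n\<close> without shifting indices, so that differential equations translate
  directly into recurrences.\<close>

interpretation rational_functions: derivation_subfield rational_functions "\<lambda>F. fls_X * fls_deriv F"
proof (intro derivation_subfield.intro subfield_rational_functions derivation_subfield_axioms.intro)
  interpret subfield_set rational_functions by (rule subfield_rational_functions)
  fix x assume x: "x \<in> rational_functions"
  then obtain A B where *: "B \<noteq> 0" "x * fls_of_poly B = fls_of_poly A"
    by (metis rational_functionsE)
  have deriv: "fls_X * fls_deriv (fls_of_poly P) \<in> rational_functions" for P
    using fls_of_poly_mem[of "[:0, 1:] * pderiv P"]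
    unfolding fps_of_poly_mult fps_of_poly_pderiv fls_times_fps_to_fls fls_deriv_fps_to_fls
      fps_of_poly_fps_X fps_X_to_fls .
  have "(fls_X * fls_deriv x) * fls_of_poly B =
      fls_X * fls_deriv (fls_of_poly A) - x * (fls_X * fls_deriv (fls_of_poly B))"
    by (simp add: algebra_simps flip: *)
  then have "fls_X * fls_deriv x =
      (fls_X * fls_deriv (fls_of_poly A) - x * (fls_X * fls_deriv (fls_of_poly B))) / fls_of_poly B"
    using * by (simp add: field_simps fls_of_poly_eq_0_iff)
  also have "\<dots> \<in> rational_functions"
    by (intro divide_mem diff_mem mult_mem[OF x] deriv fls_of_poly_mem)
  finally show "fls_X * fls_deriv x \<in> rational_functions" .
qed (auto simp: algebra_simps)

section \<open>From linear differential equations to recurrences\<close>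

lemma common_denominator:
  assumes "finite J" "\<And>j. j \<in> J \<Longrightarrow> c j \<in> rational_functions"
  obtains B q where "B \<noteq> 0" "\<And>j. j \<in> J \<Longrightarrow> fls_of_poly B * c j = fls_of_poly (q j)"
proof -
  have "\<forall>j\<in>J. \<exists>E. E \<noteq> 0 \<and> (\<exists>A. c j * fls_of_poly E = fls_of_poly A)"
    using assms(2) by (meson rational_functionsE)
  from bchoice[OF this] obtain E where E: "\<And>j. j \<in> J \<Longrightarrow> E j \<noteq> 0"
    "\<forall>j\<in>J. \<exists>A. c j * fls_of_poly (E j) = fls_of_poly A" by blast
  from bchoice[OF E(2)] obtain A where A: "\<And>j. j \<in> J \<Longrightarrow> c j * fls_of_poly (E j) = fls_of_poly (A j)"
    by blast
  show ?thesis
  proof (rule that[of "prod E J" "\<lambda>j. A j * prod E (J - {j})"])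
    show "prod E J \<noteq> 0" using E assms(1) by simp
    fix j assume "j \<in> J"
    then show "fls_of_poly (prod E J) * c j = fls_of_poly (A j * prod E (J - {j}))"
      using assms(1) by (simp add: prod.remove fps_of_poly_mult fls_times_fps_to_fls algebra_simps flip: A)
  qed
qed

text \<open>Each \<open>Q i\<close> is evaluated at the index of the term that it multiplies, as
  iterating \<open>fps_XD\<close> produces it. Any one nonzero \<open>Q i\<close> makes the
  recurrence nontrivial; it need not be the leading one.\<close>

definition p_recursive :: "(nat \<Rightarrow> 'a::field_char_0) \<Rightarrow> bool" where
  "p_recursive g \<longleftrightarrow> (\<exists>I Q. (\<exists>i\<le>I. Q i \<noteq> 0) \<and>
     (\<forall>n. (\<Sum>i\<le>I. poly (Q i) (of_nat (n + i)) * g (n + i)) = 0))"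

lemma fps_XD_iter_nth: "(fps_XD ^^ j) G $ n = of_nat n ^ j * G $ n"
  by (induction j) (simp_all add: mult.assoc)

lemma fps_XD_iter_to_fls:
  "((\<lambda>F. fls_X * fls_deriv F) ^^ j) (fps_to_fls G) = fps_to_fls ((fps_XD ^^ j) G)"
  by (induction j) (simp_all add: fls_deriv_fps_to_fls fps_XD_def fls_times_fps_to_fls)

lemma linear_ode_imp_p_recursive:
  fixes G :: "'a::field_char_0 fps"
  assumes nz: "\<exists>j\<le>d. q j \<noteq> 0"
    and ode: "(\<Sum>j\<le>d. fps_of_poly (q j) * (fps_XD ^^ j) G) = 0"
  shows "p_recursive (fps_nth G)"
proof -
  define I where "I = Max ((\<lambda>j. degree (q j)) ` {..d})"
  have I: "coeff (q j) i = 0" if "j \<le> d" "i > I" for i j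
    using that unfolding I_def by (intro coeff_eq_0) (auto simp: Max_less_iff)
  \<comment> \<open>In the coefficient of index \<open>n + I\<close> of the equation, the
    coefficient of index \<open>I - i\<close> of \<open>q j\<close> meets the coefficient of index
    \<open>n + i\<close> of \<open>(fps_XD ^^ j) G\<close>, which carries the factor
    \<open>(n + i) ^ j\<close>.\<close>
  define Q where "Q = (\<lambda>i. \<Sum>j\<le>d. monom (coeff (q j) (I - i)) j)"
  have coeff_Q: "coeff (Q i) j = coeff (q j) (I - i)" if "j \<le> d" for i j
    using that by (simp add: Q_def coeff_sum)
  have "\<exists>i\<le>I. Q i \<noteq> 0"
  proof -
    from nz obtain j where j: "j \<le> d" "q j \<noteq> 0" by auto
    then have "lead_coeff (q j) \<noteq> 0" by simp
    with I[OF j(1)] have "degree (q j) \<le> I" using linorder_not_less by blast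
    then have "coeff (Q (I - degree (q j))) j \<noteq> 0" using j by (simp add: coeff_Q)
    then show ?thesis by (intro exI[of _ "I - degree (q j)"]) auto
  qed
  moreover have "(\<Sum>i\<le>I. poly (Q i) (of_nat (n + i)) * G $ (n + i)) = 0" for n
  proof -
    have "0 = (\<Sum>j\<le>d. fps_of_poly (q j) * (fps_XD ^^ j) G) $ (n + I)"
      by (simp add: ode)
    also have "\<dots> = (\<Sum>j\<le>d. \<Sum>i\<le>n + I. coeff (q j) i * (of_nat (n + I - i) ^ j * G $ (n + I - i)))"
      by (simp add: fps_sum_nth fps_mult_nth fps_XD_iter_nth atLeast0AtMost)
    also have "\<dots> = (\<Sum>j\<le>d. \<Sum>i\<le>I. coeff (q j) i * (of_nat (n + I - i) ^ j * G $ (n + I - i)))"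
      by (intro sum.cong sum.mono_neutral_right) (auto simp: I)
    also have "\<dots> = (\<Sum>j\<le>d. \<Sum>i\<le>I. coeff (q j) (I - i) * (of_nat (n + i) ^ j * G $ (n + i)))"
      by (intro sum.cong refl sum.reindex_bij_witness[of _ "\<lambda>i. I - i" "\<lambda>i. I - i"]) auto
    also have "\<dots> = (\<Sum>i\<le>I. \<Sum>j\<le>d. coeff (q j) (I - i) * (of_nat (n + i) ^ j * G $ (n + i)))"
      by (rule sum.swap)
    also have "\<dots> = (\<Sum>i\<le>I. poly (Q i) (of_nat (n + i)) * G $ (n + i))"
      by (simp add: Q_def poly_sum poly_monom sum_distrib_right mult.assoc)
    finally show ?thesis by simp
  qed
  ultimately show ?thesis unfolding p_recursive_def by blast
qed

text \<open>\<open>H\<close> is the logarithmic derivative of \<open>F\<close>. In the application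
  \<open>H - G\<close> is \<open>1 / (1 - t)\<close>, which removes the summand 1 from the point
  counts.\<close>

lemma algebraic_imp_log_deriv_p_recursive:
  assumes "algebraic_over rational_functions (fps_to_fls F)"
    and "fps_XD F = F * H" and "F \<noteq> 0"
    and "fps_to_fls (H - G) \<in> rational_functions"
  shows "p_recursive (fps_nth G)"
proof -
  let ?D = "\<lambda>F. fls_X * fls_deriv F :: rat fls"
  let ?y = "fps_to_fls F"
  have "?D ?y / ?y - fps_to_fls (H - G) = fps_to_fls G"
    using assms(2,3) by (simp add: fls_deriv_fps_to_fls fps_XD_def field_simps flip: fps_X_to_fls fls_times_fps_to_fls)
  then obtain d c where c: "\<And>j. c j \<in> rational_functions" "\<exists>j\<le>d. c j \<noteq> 0"
      "(\<Sum>j\<le>d. c j * (?D ^^ j) (fps_to_fls G)) = 0"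
    using rational_functions.algebraic_imp_linear_ode[OF assms(1,4)] by auto
  obtain B q where B: "B \<noteq> 0" "\<And>j. j \<in> {..d} \<Longrightarrow> fls_of_poly B * c j = fls_of_poly (q j)"
    using common_denominator[of "{..d}" c] c(1) by auto
  have "\<exists>j\<le>d. q j \<noteq> 0"
  proof -
    obtain j where j: "j \<le> d" "c j \<noteq> 0" using c(2) by auto
    have "fls_of_poly (q j) \<noteq> 0"
      unfolding B(2)[symmetric, of j, simplified atMost_iff, OF j(1)] using j B(1)
      by (simp add: fls_of_poly_eq_0_iff)
    then show ?thesis using j(1) by (auto simp: fls_of_poly_eq_0_iff)
  qed
  moreover have "fps_to_fls (\<Sum>j\<le>d. fps_of_poly (q j) * (fps_XD ^^ j) G) = 0"
  proof -
    have "fps_to_fls (\<Sum>j\<le>d. fps_of_poly (q j) * (fps_XD ^^ j) G) =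
        (\<Sum>j\<le>d. fls_of_poly (q j) * (?D ^^ j) (fps_to_fls G))"
      unfolding fps_XD_iter_to_fls fls_times_fps_to_fls[symmetric]
      by (induction d) (simp_all add: atMost_Suc)
    also have "\<dots> = (\<Sum>j\<le>d. fls_of_poly B * (c j * (?D ^^ j) (fps_to_fls G)))"
      by (intro sum.cong) (simp_all flip: B)
    also have "\<dots> = 0" using c(3) by (simp flip: sum_distrib_left)
    finally show ?thesis .
  qed
  ultimately show ?thesis by (intro linear_ode_imp_p_recursive[of d q]) simp_all
qed

section \<open>Sequences governed by a p-adic valuation\<close>

lemma multiplicity_eq_if_agree_mod:
  fixes p x y :: nat
  assumes "\<not> p ^ e dvd y" "\<And>r. r \<le> e \<Longrightarrow> p ^ r dvd x \<longleftrightarrow> p ^ r dvd y"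
  shows "multiplicity p x = multiplicity p y"
proof (rule multiplicity_cong)
  fix r show "p ^ r dvd x \<longleftrightarrow> p ^ r dvd y"
    using assms le_imp_power_dvd[of e r p] by (cases "r \<le> e") (meson dvd_trans nle_le)+
qed

text \<open>\<open>k\<close> is too small to be divisible by \<open>p ^ e\<close>, so its valuation
  is visible modulo \<open>p ^ e\<close>, also up to sign. The second alternative expresses
  \<open>x = p ^ e * s - k\<close> without truncated subtraction.\<close>

lemma multiplicity_shift_eq:
  fixes p x k s :: nat
  assumes "p > 0" "0 < k" "k < p ^ e" "x = p ^ e * s + k \<or> x + k = p ^ e * s"
  shows "multiplicity p x = multiplicity p k"
proof (rule multiplicity_eq_if_agree_mod)
  show "\<not> p ^ e dvd k" using assms by (auto dest: dvd_imp_le)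
  fix r assume "r \<le> e"
  then have "p ^ r dvd p ^ e * s" by (simp add: le_imp_power_dvd)
  then show "p ^ r dvd x \<longleftrightarrow> p ^ r dvd k"
    using assms(4) by (metis dvd_add_left_iff dvd_add_right_iff)
qed

text \<open>The shape of the normalized point counts when \<open>f'(0)\<close> has multiplicative
  order \<open>m\<close>.\<close>

definition multiplicity_sequence :: "nat \<Rightarrow> nat \<Rightarrow> (nat \<Rightarrow> 'a) \<Rightarrow> 'a \<Rightarrow> nat \<Rightarrow> 'a" where
  "multiplicity_sequence p m \<phi> c n = (if m dvd n then \<phi> (multiplicity p (n div m)) else c)"

lemma multiplicity_sequence_shift_eq:
  assumes "p > 0" "m > 0" "0 < k" "k < p ^ e" "x = m * p ^ e * s + k \<or> x + k = m * p ^ e * s"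
  shows "multiplicity_sequence p m \<phi> c x = multiplicity_sequence p m \<phi> c k"
proof -
  have iff: "m dvd x \<longleftrightarrow> m dvd k"
    using assms(5) by (metis dvd_add_left_iff dvd_add_right_iff dvd_triv_left mult.assoc)
  show ?thesis
  proof (cases "m dvd k")
    case True
    then obtain k' x' where [simp]: "k = m * k'" "x = m * x'"
      using iff by (auto elim!: dvdE)
    have "m * x' = m * (p ^ e * s + k') \<or> m * (x' + k') = m * (p ^ e * s)"
      using assms(5) by (simp add: algebra_simps)
    then have "x' = p ^ e * s + k' \<or> x' + k' = p ^ e * s"
      using assms(2) by (metis mult_left_cancel neq0_conv)
    moreover have "k' > 0" "k' < p ^ e"
      using assms(2-4) by (auto intro: le_less_trans[of _ "m * k'"])
    ultimately have "multiplicity p x' = multiplicity p k'"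
      using assms(1) by (intro multiplicity_shift_eq)
    then show ?thesis using assms(2) by (simp add: multiplicity_sequence_def)
  qed (simp add: multiplicity_sequence_def iff)
qed

text \<open>The numbers \<open>p ^ e * (1 + p * t)\<close> all have valuation \<open>e\<close> and
  stay distinct in characteristic 0, which gives \<open>R\<close> infinitely many roots.\<close>

lemma poly_eq_0_if_vanishes_on_multiplicity_class:
  fixes R :: "'a::field_char_0 poly"
  assumes "prime p" "\<And>s. s > 0 \<Longrightarrow> multiplicity p s = e \<Longrightarrow> poly R (of_nat s) = 0"
  shows "R = 0"
proof (rule ccontr)
  assume "R \<noteq> 0"
  have p: "p > 0" using assms(1) by (simp add: prime_gt_0_nat)
  let ?h = "\<lambda>t::nat. of_nat (p ^ e * (1 + p * t)) :: 'a"
  have "range ?h \<subseteq> {x. poly R x = 0}"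
  proof safe
    fix t
    have "\<not> p dvd 1 + p * t"
      using assms(1) by (metis dvd_add_left_iff dvd_triv_left not_prime_unit)
    then have "multiplicity p (p ^ e * (1 + p * t)) = e"
      using p by (intro multiplicity_decomposeI[of _ _ _ "1 + p * t"]) auto
    then show "poly R (?h t) = 0" using p by (intro assms(2)) auto
  qed
  moreover have "inj ?h" using p by (auto simp: inj_def)
  ultimately show False
    using \<open>R \<noteq> 0\<close> poly_roots_finite finite_subset finite_imageD infinite_UNIV_nat by metis
qed

text \<open>
  For \<open>n\<close> near multiples \<open>m p\<^sup>E s\<close> all terms of a recurrence of order less than \<open>p\<^sup>E\<close> but one
  have coefficients polynomial in \<open>s\<close>, whereas the remaining one still depends on \<open>v\<^sub>p(s)\<close>.
\<close>

lemma multiplicity_sequence_not_p_recursive: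
  fixes D :: "'a::field_char_0"
  assumes p: "prime p" and m: "m > 0" and D: "D \<noteq> 0"
    and phi: "\<And>e. \<phi> e \<noteq> \<phi> (Suc e)"
    and g: "\<And>n. n > 0 \<Longrightarrow> g n = D ^ n * multiplicity_sequence p m \<phi> c n"
  shows "\<not> p_recursive g"
proof
  assume "p_recursive g"
  then obtain I Q k where k: "k \<le> I" "Q k \<noteq> 0"
    and rec: "\<And>n. (\<Sum>i\<le>I. poly (Q i) (of_nat (n + i)) * g (n + i)) = 0"
    unfolding p_recursive_def by auto
  define b where "b = multiplicity_sequence p m \<phi> c"
  define M where "M = m * p ^ I"
  \<comment> \<open>For \<open>n = M * s - k\<close>, this is the distance from \<open>n + i\<close>
    to \<open>M * s\<close>.\<close>
  define d where "d = (\<lambda>i. if i > k then i - k else k - i)"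
  have p_gt: "p > 1" by (rule prime_gt_1_nat[OF p])
  have I: "I < p ^ I" using p_gt by (simp add: power_gt_expt)
  have M: "M > I" "M > 0" using I m p_gt unfolding M_def
    by (auto intro: less_le_trans)
  \<comment> \<open>The recurrence at \<open>n = M * s - k\<close> with \<open>D ^ n\<close> divided
    out: \<open>A\<close> comes from the term \<open>i = k\<close>, which falls exactly on
    \<open>M * s\<close>, and \<open>C\<close> collects the other terms, whose values
    \<open>b (d i)\<close> do not depend on \<open>s\<close>.\<close>
  define A where "A = smult (D ^ k) (pcompose (Q k) [:0, of_nat M:])"
  define C where "C = (\<Sum>i\<in>{..I}-{k}. smult (D ^ i * b (d i)) (pcompose (Q i) [:of_nat i - of_nat k, of_nat M:]))"
  have key: "poly A (of_nat s) * \<phi> (I + multiplicity p s) + poly C (of_nat s) = 0" if s: "s > 0" for s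
  proof -
    define n where "n = M * s - k"
    have "I < M * s" using M(1) s by (auto intro: less_le_trans)
    then have n: "n + i = M * s + i - k" "n + i > 0" "M * s + i > k" for i
      using k(1) unfolding n_def by auto
    have of_nat_n: "of_nat (n + i) = of_nat i - of_nat k + of_nat s * (of_nat M :: 'a)" for i
      using n(3)[of i] unfolding n(1) by (simp add: of_nat_diff)
    have "b (n + i) = b (d i)" if i: "i \<le> I" "i \<noteq> k" for i
      unfolding b_def
    proof (rule multiplicity_sequence_shift_eq[where e = I and s = s])
      show "0 < d i" "d i < p ^ I" using i k(1) I by (auto simp: d_def)
      show "n + i = m * p ^ I * s + d i \<or> n + i + d i = m * p ^ I * s"
        using n(1)[of i] n(3)[of i] n(3)[of 0] i by (auto simp: d_def M_def)
    qed (use p_gt m in auto)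
    moreover have "b (n + k) = \<phi> (I + multiplicity p s)"
    proof -
      have "multiplicity p (p ^ I * s) = I + multiplicity p s"
        using p s p_gt by (subst prime_elem_multiplicity_mult_distrib) auto
      then show ?thesis
        using n(1)[of k] m by (simp add: b_def multiplicity_sequence_def M_def mult.assoc)
    qed
    moreover have "0 = (\<Sum>i\<le>I. poly (Q i) (of_nat (n + i)) * (D ^ (n + i) * b (n + i)))"
      using rec[of n] g n(2) by (simp add: b_def)
    ultimately have "0 = poly (Q k) (of_nat (n + k)) * (D ^ (n + k) * \<phi> (I + multiplicity p s)) +
        (\<Sum>i\<in>{..I}-{k}. poly (Q i) (of_nat (n + i)) * (D ^ (n + i) * b (d i)))"
      using k(1) by (simp add: sum.remove)
    also have "\<dots> = D ^ n * (poly A (of_nat s) * \<phi> (I + multiplicity p s) + poly C (of_nat s))"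
      unfolding of_nat_n
      by (simp add: A_def C_def poly_pcompose poly_sum power_add algebra_simps sum_distrib_left)
    finally show ?thesis using D by simp
  qed
  \<comment> \<open>On the \<open>s\<close> of valuation \<open>e\<close> the factor
    \<open>\<phi>\<close> is constant, so the relation is an identity of polynomials. Comparing two
    values of \<open>e\<close> then eliminates \<open>C\<close>.\<close>
  have "smult (\<phi> (I + e)) A + C = 0" for e
    using p by (rule poly_eq_0_if_vanishes_on_multiplicity_class[where e = e]) (use key in \<open>auto simp: mult.commute\<close>)
  from this[of 0] this[of 1] have "smult (\<phi> I) A = smult (\<phi> (Suc I)) A"
    by (simp add: eq_neg_iff_add_eq_0[symmetric])
  then have "smult (\<phi> I - \<phi> (Suc I)) A = 0"
    by (simp add: smult_diff_left)
  then have "pcompose (Q k) [:0, of_nat M:] = 0"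
    using phi[of I] D by (simp add: A_def)
  then show False using k(2) M(2) pcompose_eq_0[of "Q k" "[:0, of_nat M:]"] by simp
qed

section \<open>Zeta functions\<close>

text \<open>By the chain rule for the exponential; \<open>fps_XD\<close> cancels the division by
  \<open>n\<close> in the exponent.\<close>

lemma fps_XD_artin_mazur_zeta:
  "fps_XD (artin_mazur_zeta f X) =
     artin_mazur_zeta f X * Abs_fps (\<lambda>n. if n = 0 then 0 else of_nat (card (Per f X n)))"
proof -
  define L :: "rat fps" where "L = Abs_fps (\<lambda>n. if n = 0 then 0 else of_nat (card (Per f X n)) / of_nat n)"
  have L: "artin_mazur_zeta f X = fps_exp 1 oo L" by (simp add: artin_mazur_zeta_def L_def)
  have "fps_deriv (artin_mazur_zeta f X) = artin_mazur_zeta f X * fps_deriv L"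
    unfolding L by (subst fps_compose_deriv) (simp_all add: L_def)
  then have "fps_XD (artin_mazur_zeta f X) = artin_mazur_zeta f X * fps_XD L"
    by (simp add: fps_XD_def mult.left_commute)
  also have "fps_XD L = Abs_fps (\<lambda>n. if n = 0 then 0 else of_nat (card (Per f X n)))"
    by (rule fps_ext) (simp add: L_def)
  finally show ?thesis .
qed

lemma artin_mazur_zeta_nth_0 [simp]: "artin_mazur_zeta f X $ 0 = 1"
  by (simp add: artin_mazur_zeta_def)

lemma fps_XD_mult: "fps_XD (F * G) = fps_XD F * G + F * fps_XD (G :: 'a::comm_ring_1 fps)"
  by (simp add: fps_XD_def algebra_simps)

lemma fps_XD_eq_0_iff: "fps_XD F = 0 \<longleftrightarrow> F = fps_const (F $ 0 :: 'a::field_char_0)"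
  by (simp add: fps_XD_def)

lemma geometric_fps: "Abs_fps (\<lambda>n. D ^ n) * (1 - fps_const D * fps_X) = (1 :: 'a::comm_ring_1 fps)"
proof (rule fps_ext)
  fix n show "(Abs_fps (\<lambda>n. D ^ n) * (1 - fps_const D * fps_X)) $ n = (1 :: 'a fps) $ n"
    by (cases n) (simp_all add: right_diff_distrib mult.left_commute[of _ "fps_const D"])
qed

text \<open>The zeta function times \<open>(1 - t) (1 - D t)\<close> has derivative 0 and constant
  term 1, hence is 1.\<close>

lemma artin_mazur_zeta_rational:
  fixes D :: nat
  assumes "\<And>n. n > 0 \<Longrightarrow> card (Per f X n) = 1 + D ^ n"
  shows "fps_to_fls (artin_mazur_zeta f X) \<in> rational_functions"
proof -
  let ?Z = "artin_mazur_zeta f X"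
  define E where "E = (\<lambda>c::rat. 1 - fps_const c * fps_X)"
  define S where "S = (\<lambda>c::rat. Abs_fps (\<lambda>n. c ^ n))"
  let ?D = "of_nat D :: rat"
  have S: "S c * E c = 1" "E c * S c = 1" for c
    using geometric_fps[of c] by (simp_all add: S_def E_def mult.commute)
  have XDE: "fps_XD (E c) = E c - 1" for c
    by (simp add: fps_XD_def E_def mult.commute)
  have H: "Abs_fps (\<lambda>n. if n = 0 then 0 else of_nat (card (Per f X n))) = (S 1 - 1) + (S ?D - 1)"
    by (rule fps_ext) (simp add: assms S_def fps_numeral_nth)
  \<comment> \<open>The left side has the shape of the derivative computed below; the right side
    vanishes once \<open>s * a = 1\<close> and \<open>t * b = 1\<close> are inserted for the
    geometric series.\<close>
  have alg: "z * (s - 1 + (t - 1)) * (a * b) + z * ((a - 1) * b + a * (b - 1)) =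
      z * ((s * a - 1) * b + (t * b - 1) * a)" for z s t a b :: "rat fps"
    by algebra
  have "fps_XD (?Z * (E 1 * E ?D)) = 0"
    unfolding fps_XD_mult fps_XD_artin_mazur_zeta H XDE alg S by simp
  then have "?Z * (E 1 * E ?D) = 1"
    unfolding fps_XD_eq_0_iff by (simp add: E_def)
  moreover have "E c = fps_of_poly [:1, -c:]" for c
    by (simp add: E_def fps_of_poly_pCons flip: fps_const_neg)
  ultimately have "?Z * fps_of_poly ([:1, -1:] * [:1, - ?D:]) = fps_of_poly 1"
    by (simp only: fps_of_poly_mult fps_of_poly_1)
  then show ?thesis
    by (intro rational_functionsI'[of "[:1, -1:] * [:1, - ?D:]" _ 1])
      (simp_all only: fls_times_fps_to_fls[symmetric] no_zero_divisors pCons_eq_0_iff one_neq_zero simp_thms not_False_eq_True)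
qed

lemma artin_mazur_zeta_transcendental:
  fixes D p m :: nat and \<phi> :: "nat \<Rightarrow> rat"
  assumes "prime p" "m > 0" "D > 0" "\<And>e. \<phi> e \<noteq> \<phi> (Suc e)"
    and "\<And>n. n > 0 \<Longrightarrow>
      of_nat (card (Per f X n)) = 1 + of_nat D ^ n * multiplicity_sequence p m \<phi> c n"
  shows "transcendental_over rational_functions (fps_to_fls (artin_mazur_zeta f X))"
  unfolding transcendental_over_def
proof
  assume alg: "algebraic_over rational_functions (fps_to_fls (artin_mazur_zeta f X))"
  define H :: "rat fps" where "H = Abs_fps (\<lambda>n. if n = 0 then 0 else of_nat (card (Per f X n)))"
  \<comment> \<open>At positive indices this is the point count without its summand 1. The value -1
    at index 0 does no harm, since the shape of the sequence is prescribed only for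
    \<open>n > 0\<close>.\<close>
  define G where "G = H - Abs_fps (\<lambda>n. 1)"
  have "Abs_fps (\<lambda>n. 1) * fps_of_poly [:1, -1:] = (1 :: rat fps)"
    using geometric_fps[of "1 :: rat"] by (simp add: fps_of_poly_pCons flip: fps_const_neg)
  then have "fps_to_fls (Abs_fps (\<lambda>n. 1)) * fls_of_poly [:1, -1:] = fls_of_poly 1"
    by (simp only: fps_of_poly_1 flip: fls_times_fps_to_fls)
  then have "fps_to_fls (H - G) \<in> rational_functions"
    by (intro rational_functionsI'[of "[:1, -1:]"]) (simp only: G_def diff_diff_eq2 add_diff_cancel_left' pCons_eq_0_iff one_neq_zero simp_thms not_False_eq_True)+
  moreover have "artin_mazur_zeta f X \<noteq> 0"
    by (metis artin_mazur_zeta_nth_0 fps_zero_nth zero_neq_one)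
  ultimately have "p_recursive (fps_nth G)"
    using alg fps_XD_artin_mazur_zeta[of f X] by (intro algebraic_imp_log_deriv_p_recursive) (simp_all add: H_def)
  moreover have "\<not> p_recursive (fps_nth G)"
    using assms by (intro multiplicity_sequence_not_p_recursive[where D = "of_nat D" and \<phi> = \<phi> and c = c]) (simp_all add: G_def H_def)
  ultimately show False by contradiction
qed

section \<open>Algebraic elements over the prime field\<close>

lemma (in subfield_set) finite_fspan:
  assumes "finite S"
  shows "finite (fspan e n)"
proof -
  have "fspan e n \<subseteq> (\<lambda>c. \<Sum>i<n. c i * e i) ` ({..<n} \<rightarrow>\<^sub>E S)"
  proof
    fix v assume "v \<in> fspan e n"
    then obtain c where "\<And>i. c i \<in> S" "v = (\<Sum>i<n. c i * e i)" by (metis fspanE)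
    then show "v \<in> (\<lambda>c. \<Sum>i<n. c i * e i) ` ({..<n} \<rightarrow>\<^sub>E S)"
      by (intro image_eqI[of _ _ "restrict c {..<n}"]) auto
  qed
  then show ?thesis using assms by (meson finite_PiE finite_imageI finite_lessThan finite_subset)
qed

text \<open>All powers of \<open>b\<close> lie in a finitely generated span over the finite field
  \<open>S\<close>. That span is finite, so two powers coincide.\<close>

lemma (in subfield_set) finite_algebraic_imp_root_of_unity:
  assumes "finite S" "algebraic_over S b" "b \<noteq> 0"
  shows "\<exists>n>0. b ^ n = 1"
proof -
  obtain P where P: "\<And>i. coeff P i \<in> S" "P \<noteq> 0" "poly P b = 0"
    using assms(2) by (auto simp: algebraic_over_def)
  have "range (\<lambda>n. b ^ n) \<subseteq> fspan (\<lambda>i. b ^ i) (degree P)"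
    using powspan_power[OF P gen_mem_powspan[OF P]] by auto
  then have "finite (range (\<lambda>n. b ^ n))"
    using finite_fspan[OF assms(1)] finite_subset by blast
  then have "\<not> inj (\<lambda>n::nat. b ^ n)"
    using finite_imageD infinite_UNIV_nat by blast
  then obtain i j where ij: "i < j" "b ^ i = b ^ j"
    by (metis injI linorder_neqE_nat)
  then have "b ^ i * 1 = b ^ i * b ^ (j - i)"
    by (metis le_add_diff_inverse less_imp_le mult_1_right power_add)
  then have "b ^ (j - i) = 1" using assms(3) by simp
  then show ?thesis using ij(1) by (intro exI[of _ "j - i"]) simp
qed

lemma finite_prime_field:
  assumes "CHAR('a::field) > 0"
  shows "finite (prime_field :: 'a set)"
proof -
  have "(of_int x :: 'a) \<in> of_int ` {0..<int CHAR('a)}" for x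
  proof
    have "of_int x = (of_int (x mod int CHAR('a) + int CHAR('a) * (x div int CHAR('a))) :: 'a)"
      by simp
    also have "\<dots> = of_int (x mod int CHAR('a))"
      unfolding of_int_add of_int_mult by simp
    finally show "of_int x = (of_int (x mod int CHAR('a)) :: 'a)" .
  qed (use assms in simp)
  then have "(prime_field :: 'a set) \<subseteq> of_int ` {0..<int CHAR('a)}"
    by (auto simp: prime_field_def)
  then show ?thesis by (rule finite_subset) simp
qed

lemma subfield_prime_field:
  assumes "CHAR('a::field) > 0"
  shows "subfield_set (prime_field :: 'a set)"
proof
  fix x :: 'a assume "x \<in> prime_field"
  then obtain a where a: "x = of_int a" by (auto simp: prime_field_def)
  show "inverse x \<in> prime_field"
  proof (cases "x = 0")
    case False
    have "prime (int CHAR('a))" using prime_CHAR_semidom[OF assms] by simp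
    moreover have "\<not> int CHAR('a) dvd a"
      using False of_int_eq_0_iff_char_dvd a by blast
    ultimately have "gcd a (int CHAR('a)) = 1"
      by (metis coprime_iff_gcd_eq_1 coprime_commute prime_imp_coprime)
    then obtain u v where "u * a + v * int CHAR('a) = 1"
      using bezout_int[of a "int CHAR('a)"] by auto
    then have "of_int u * x + of_int v * of_nat CHAR('a) = (1 :: 'a)"
      unfolding a by (metis of_int_1 of_int_add of_int_mult of_int_of_nat_eq)
    then have "of_int u * x = 1" by simp
    then have "inverse x = of_int u" by (metis inverse_unique mult.commute)
    then show ?thesis by (simp add: prime_field_def)
  qed (use \<open>x \<in> prime_field\<close> in simp)
qed (auto simp: prime_field_def image_iff intro: exI[of _ 1], (metis of_int_diff of_int_mult)+)

text \<open>Translates the algebraicity condition on \<open>f'(0)\<close> into finite multiplicative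
  order, which is what the point counts depend on.\<close>

lemma algebraic_over_prime_field_iff:
  fixes b :: "'a::field"
  assumes "CHAR('a) > 0" "b \<noteq> 0"
  shows "algebraic_over prime_field b \<longleftrightarrow> (\<exists>n>0. b ^ n = 1)"
proof
  assume "algebraic_over prime_field b"
  then show "\<exists>n>0. b ^ n = 1"
    using subfield_set.finite_algebraic_imp_root_of_unity[OF subfield_prime_field]
      finite_prime_field assms by blast
next
  assume "\<exists>n>0. b ^ n = 1"
  then obtain n where n: "n > 0" "b ^ n = 1" by auto
  have "coeff (monom (1::'a) n - 1) n = 1" using n(1) by simp
  then have "monom (1::'a) n - 1 \<noteq> 0" by (metis coeff_0 zero_neq_one)
  moreover have "coeff (monom (1::'a) n - 1) i \<in> prime_field" for i
  proof -
    have "coeff (monom (1::'a) n - 1) i =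
        of_int ((if i = n then 1 else 0) - (if i = 0 then 1 else 0))"
      by (simp add: coeff_1)
    then show ?thesis unfolding prime_field_def by blast
  qed
  ultimately show "algebraic_over prime_field b"
    unfolding algebraic_over_def using n(2)
    by (intro exI[of _ "monom 1 n - 1"]) (auto simp: poly_monom)
qed

section \<open>Additive polynomials\<close>

lemma infinite_UNIV_alg_closed: "infinite (UNIV :: 'a::alg_closed_field set)"
proof
  assume fin: "finite (UNIV :: 'a set)"
  \<comment> \<open>Over a finite field this polynomial of positive degree would take only the value
    1.\<close>
  let ?P = "(\<Prod>a\<in>UNIV. [:- a, 1:]) + (1 :: 'a poly)"
  have "degree (\<Prod>a\<in>UNIV. [:- a, 1 :: 'a:]) = card (UNIV :: 'a set)"
    by (subst degree_prod_sum_eq) auto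
  moreover have "card (UNIV :: 'a set) > 0" using fin by (simp add: card_gt_0_iff)
  ultimately have "degree ?P > 0" by (subst degree_add_eq_left) auto
  then obtain x where "poly ?P x = 0" using alg_closed_imp_poly_has_root by blast
  moreover have "poly (\<Prod>a\<in>UNIV. [:- a, 1 :: 'a:]) x = 0"
    using fin by (auto simp: poly_prod prod_zero_iff)
  ultimately show False by simp
qed

lemma poly_eqI_alg_closed:
  fixes P Q :: "'a::alg_closed_field poly"
  assumes "\<And>x. poly P x = poly Q x"
  shows "P = Q"
proof (rule ccontr)
  assume "P \<noteq> Q"
  then have "finite {x. poly (P - Q) x = 0}" by (intro poly_roots_finite) simp
  moreover have "{x. poly (P - Q) x = 0} = UNIV" using assms by simp
  ultimately show False using infinite_UNIV_alg_closed by metis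
qed

lemma size_proots_alg_closed: "size (proots (P :: 'a::alg_closed_field poly)) = degree P"
proof (cases "P = 0")
  case False
  obtain A where A: "size A = degree P" "P = smult (lead_coeff P) (\<Prod>x\<in>#A. [:- x, 1:])"
    using alg_closed_imp_factorization[OF False] by blast
  have "proots P = proots (\<Prod>x\<in>#A. [:- x, 1:])"
    by (subst A(2), rule proots_smult) (use False in simp)
  also have "\<dots> = A"
    by (induction A) (simp_all add: proots_mult prod_mset_zero_iff image_iff del: mult_pCons_left)
  finally show ?thesis using A(1) by simp
qed simp

section \<open>Additive polynomials and their fibers\<close>

lemma order_0_shift:
  assumes "P \<noteq> 0"
  shows "order 0 (pcompose P [:x, 1:]) = order x (P :: 'a::field poly)"
proof -
  obtain q where q: "P = [:- x, 1:] ^ order x P * q" "\<not> [:- x, 1:] dvd q"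
    using order_decomp[OF assms] by blast
  have shift: "pcompose ([:- x, 1:] ^ n * q) [:x, 1:] = [:0, 1:] ^ n * pcompose q [:x, 1:]" for n
    by (induction n) (simp_all add: pcompose_mult pcompose_pCons mult.assoc del: mult_pCons_left)
  have *: "poly (pcompose q [:x, 1:]) 0 \<noteq> 0"
    using q(2) by (simp add: poly_pcompose poly_eq_0_iff_dvd)
  then have "[:0, 1:] ^ order x P * pcompose q [:x, 1:] \<noteq> 0"
    by (auto simp del: mult_pCons_left)
  then have "order 0 (pcompose P [:x, 1:]) = order x P + order 0 (pcompose q [:x, 1:])"
    using order_power_n_n[of "0 :: 'a" "order x P"]
    by (subst q(1), subst shift, subst order_mult) (simp_all del: mult_pCons_left)
  then show ?thesis using * by (simp add: order_0I)
qed

text \<open>Additivity of values passes at once to differences, multiples and compositions, unlike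
  the explicit form in \<open>additive_poly\<close>.\<close>

definition additive_fun :: "'a::field poly \<Rightarrow> bool" where
  "additive_fun L \<longleftrightarrow> (\<forall>x y. poly L (x + y) = poly L x + poly L y)"

lemma additive_funD: "additive_fun L \<Longrightarrow> poly L (x + y) = poly L x + poly L y"
  by (simp add: additive_fun_def)

lemma additive_fun_0: "additive_fun L \<Longrightarrow> poly L 0 = 0"
  using additive_funD[of L 0 0] by (metis add.right_neutral add_left_cancel)

lemma additive_fun_of_nat_mult: "additive_fun L \<Longrightarrow> poly L (of_nat n * x) = of_nat n * poly L x"
  by (induction n) (simp_all add: additive_fun_0 additive_funD distrib_right)

lemma additive_fun_sum: "additive_fun L \<Longrightarrow> poly L (sum g A) = (\<Sum>x\<in>A. poly L (g x))"
  by (induction A rule: infinite_finite_induct) (simp_all add: additive_fun_0 additive_funD)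

lemma additive_fun_diff: "additive_fun L \<Longrightarrow> additive_fun M \<Longrightarrow> additive_fun (L - M)"
  by (simp add: additive_fun_def)

lemma additive_fun_smult: "additive_fun L \<Longrightarrow> additive_fun (smult c L)"
  by (simp add: additive_fun_def distrib_left)

lemma additive_fun_linear: "additive_fun [:0, c:]"
  by (simp add: additive_fun_def algebra_simps)

lemma additive_fun_pcompose: "additive_fun L \<Longrightarrow> additive_fun M \<Longrightarrow> additive_fun (pcompose L M)"
  by (simp add: additive_fun_def poly_pcompose)

text \<open>Each monomial is a multiple of a Frobenius power, which is additive in characteristic
  \<open>p\<close>.\<close>

lemma additive_poly_imp_additive_fun:
  fixes L :: "'a::field poly"
  assumes "CHAR('a) > 0" "additive_poly L"
  shows "additive_fun L"
proof -
  have "prime CHAR('a)" using prime_CHAR_semidom assms(1) .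
  then show ?thesis
    using assms(2) unfolding additive_poly_def additive_fun_def
    by (auto simp: poly_sum poly_monom freshmans_dream' distrib_left sum.distrib)
qed

lemma additive_fun_shift:
  fixes L :: "'a::alg_closed_field poly"
  assumes "additive_fun L"
  shows "pcompose L [:x, 1:] = L + [:poly L x:]"
  by (rule poly_eqI_alg_closed) (use assms in \<open>simp add: poly_pcompose additive_funD\<close>)

text \<open>Translating the argument changes \<open>L\<close> only by a constant, so the derivative
  is translation invariant.\<close>

lemma pderiv_additive_fun:
  fixes L :: "'a::alg_closed_field poly"
  assumes "additive_fun L"
  shows "pderiv L = [:coeff L 1:]"
proof (rule poly_eqI_alg_closed)
  fix x
  have "poly (pderiv (pcompose L [:x, 1:])) 0 = poly (pderiv L) 0"
    unfolding additive_fun_shift[OF assms] by (simp add: pderiv_add pderiv_pCons)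
  then have "poly (pderiv L) x = poly (pderiv L) 0"
    by (simp add: pderiv_pcompose poly_pcompose pderiv_pCons)
  then show "poly (pderiv L) x = poly [:coeff L 1:] x"
    by (simp add: poly_0_coeff_0 coeff_pderiv)
qed

lemma degree_additive_fun_pos:
  assumes "additive_fun L" "L \<noteq> 0"
  shows "degree L > 0"
  using assms additive_fun_0[OF assms(1)] by (metis degree_0_id gr0I poly_0_coeff_0 pCons_0_0)

text \<open>By translation invariance all roots of \<open>L - c\<close> have the multiplicity that \<open>L\<close> has at 0.\<close>

lemma card_additive_fun_fiber:
  fixes L :: "'a::alg_closed_field poly"
  assumes "additive_fun L" "L \<noteq> 0"
  shows "card {x. poly L x = c} * order 0 L = degree L"
proof -
  define R where "R = L - [:c:]"
  have deg: "degree R = degree L"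
    unfolding R_def diff_conv_add_uminus
    by (rule degree_add_eq_left) (use degree_additive_fun_pos[OF assms] in simp)
  then have "R \<noteq> 0" using degree_additive_fun_pos[OF assms] by auto
  have roots: "poly R x = 0 \<longleftrightarrow> poly L x = c" for x by (simp add: R_def)
  have order: "order x R = order 0 L" if "poly L x = c" for x
    using order_0_shift[OF \<open>R \<noteq> 0\<close>, of x] that
    by (simp add: R_def pcompose_diff additive_fun_shift[OF assms(1)])
  have "degree L = size (proots R)" by (simp add: deg size_proots_alg_closed)
  also have "\<dots> = (\<Sum>x | poly L x = c. order x R)"
    using \<open>R \<noteq> 0\<close> by (simp add: size_multiset_overloaded_eq roots)
  also have "\<dots> = (\<Sum>x | poly L x = c. order 0 L)"
    by (intro sum.cong) (simp_all add: order)
  finally show ?thesis by simp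
qed

section \<open>Iterates and their orders of vanishing at 0\<close>

definition poly_iter :: "'a::field poly \<Rightarrow> nat \<Rightarrow> 'a poly" where
  "poly_iter L n = (pcompose L ^^ n) [:0, 1:]"

lemma poly_iter_0 [simp]: "poly_iter L 0 = [:0, 1:]"
  and poly_iter_Suc: "poly_iter L (Suc n) = pcompose L (poly_iter L n)"
  by (simp_all add: poly_iter_def)

lemma poly_iter_1 [simp]: "poly_iter L (Suc 0) = L"
  by (simp add: poly_iter_Suc)

lemma poly_poly_iter: "poly (poly_iter L n) x = (poly L ^^ n) x"
  by (induction n) (simp_all add: poly_iter_Suc poly_pcompose)

lemma degree_poly_iter: "degree (poly_iter L n) = degree L ^ n"
  by (induction n) (simp_all add: poly_iter_Suc degree_pcompose)

lemma poly_iter_poly_iter: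
  fixes L :: "'a::alg_closed_field poly"
  shows "poly_iter (poly_iter L m) n = poly_iter L (m * n)"
proof (rule poly_eqI_alg_closed)
  have "poly (poly_iter L m) = poly L ^^ m" by (simp add: fun_eq_iff poly_poly_iter)
  then show "poly (poly_iter (poly_iter L m) n) x = poly (poly_iter L (m * n)) x" for x
    by (simp add: poly_poly_iter funpow_mult)
qed

lemma additive_fun_poly_iter: "additive_fun L \<Longrightarrow> additive_fun (poly_iter L n)"
  by (induction n) (simp_all add: poly_iter_Suc additive_fun_linear additive_fun_pcompose)

lemma coeff_1_pcompose:
  fixes f g :: "'a::field poly"
  assumes "poly g 0 = 0"
  shows "coeff (pcompose f g) 1 = coeff f 1 * coeff g 1"
proof -
  have *: "coeff p 1 = poly (pderiv p) 0" for p :: "'a poly"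
    by (simp add: poly_0_coeff_0 coeff_pderiv)
  show ?thesis by (simp only: * pderiv_pcompose poly_mult poly_pcompose assms)
qed

lemma coeff_1_poly_iter:
  assumes "poly L 0 = 0"
  shows "coeff (poly_iter L n) 1 = coeff L 1 ^ n"
proof (induction n)
  case (Suc n)
  have "poly (poly_iter L n) 0 = 0" using assms by (induction n) (simp_all add: poly_iter_Suc poly_pcompose)
  then show ?case by (simp only: poly_iter_Suc coeff_1_pcompose Suc.IH power_Suc)
qed simp

text \<open>Splitting off the power of \<open>x\<close> in \<open>f\<close> leaves \<open>q\<close>
  with \<open>q(0) \<noteq> 0\<close>; then \<open>f(g)\<close> is \<open>g ^ order 0 f\<close>
  times \<open>q(g)\<close>, and the last factor does not vanish at 0.\<close>

lemma order_0_pcompose: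
  fixes f g :: "'a::field poly"
  assumes "f \<noteq> 0" "g \<noteq> 0" "poly g 0 = 0"
  shows "order 0 (pcompose f g) = order 0 f * order 0 g"
proof -
  obtain q where q: "f = [:- 0, 1:] ^ order 0 f * q" "\<not> [:- 0, 1:] dvd q"
    using order_decomp[OF assms(1)] by blast
  then have q0: "poly q 0 \<noteq> 0" by (simp add: poly_eq_0_iff_dvd)
  then have *: "poly (pcompose q g) 0 \<noteq> 0"
    using assms(3) by (simp add: poly_pcompose)
  then have nz: "pcompose q g \<noteq> 0" by auto
  have "pcompose ([:- 0, 1:] ^ n * q) g = g ^ n * pcompose q g" for n
    by (induction n) (simp_all add: pcompose_mult pcompose_pCons)
  then have "pcompose f g = g ^ order 0 f * pcompose q g"
    using q(1) by metis
  moreover have "order 0 (g ^ n) = n * order 0 g" for n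
    using assms(2) by (induction n) (simp_all add: order_mult)
  ultimately show ?thesis
    using assms(2) nz * by (simp add: order_mult order_0I)
qed

lemma poly_iter_nonzero: "degree L > 0 \<Longrightarrow> poly_iter L n \<noteq> 0"
  using degree_poly_iter[of L n] by (metis degree_0 power_eq_0_iff not_gr0)

lemma order_0_poly_iter:
  assumes "degree L > 0" "poly L 0 = 0"
  shows "order 0 (poly_iter L n) = order 0 L ^ n"
proof (induction n)
  case 0
  show ?case using order_power_n_n[of "0::'a" 1] by simp
next
  case (Suc n)
  have "poly (poly_iter L n) 0 = 0" using assms by (induction n) (simp_all add: poly_iter_Suc poly_pcompose)
  moreover have "L \<noteq> 0" using assms(1) by auto
  ultimately show ?case using assms Suc poly_iter_nonzero[of L n]
    by (simp add: poly_iter_Suc order_0_pcompose)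
qed

text \<open>The binomial theorem for \<open>(1 + u)\<^sup>s\<close> in the ring of additive polynomials under composition.\<close>

lemma poly_iter_id_plus:
  fixes u :: "'a::alg_closed_field poly"
  assumes "additive_fun u"
  shows "poly_iter ([:0, 1:] + u) s = (\<Sum>i\<le>s. smult (of_nat (s choose i)) (poly_iter u i))"
proof (rule poly_eqI_alg_closed)
  fix x
  let ?v = "\<lambda>i. (poly u ^^ i) x"
  have "(poly ([:0, 1:] + u) ^^ s) x = (\<Sum>i\<le>s. of_nat (s choose i) * ?v i)"
  proof (induction s)
    case (Suc s)
    let ?C = "\<lambda>i. of_nat (s choose i) :: 'a"
    have "(poly ([:0, 1:] + u) ^^ Suc s) x = (\<Sum>i\<le>s. ?C i * ?v i) + (\<Sum>i\<le>s. ?C i * ?v (Suc i))"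
      unfolding funpow.simps(2) comp_apply Suc
      by (simp add: additive_fun_sum[OF assms] additive_fun_of_nat_mult[OF assms])
    also have "(\<Sum>i\<le>s. ?C i * ?v i) = (\<Sum>i\<le>Suc s. ?C i * ?v i)"
      by (simp add: binomial_eq_0)
    also have "\<dots> = ?v 0 + (\<Sum>i\<le>s. ?C (Suc i) * ?v (Suc i))"
      by (simp add: sum.atMost_Suc_shift del: sum.atMost_Suc funpow.simps)
    also have "\<dots> + (\<Sum>i\<le>s. ?C i * ?v (Suc i)) =
        ?v 0 + (\<Sum>i\<le>s. of_nat (Suc s choose Suc i) * ?v (Suc i))"
      by (simp add: sum.distrib algebra_simps del: funpow.simps)
    also have "\<dots> = (\<Sum>i\<le>Suc s. of_nat (Suc s choose i) * ?v i)"
      by (subst sum.atMost_Suc_shift) simp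
    finally show ?case .
  qed simp
  then show "poly (poly_iter ([:0, 1:] + u) s) x =
      poly (\<Sum>i\<le>s. smult (of_nat (s choose i)) (poly_iter u i)) x"
    by (simp add: poly_poly_iter poly_sum)
qed

text \<open>The prime characteristic divides all binomial coefficients except the two outer
  ones.\<close>

lemma poly_iter_id_plus_CHAR:
  fixes u :: "'a::alg_closed_field poly"
  assumes char_pos: "CHAR('a) > 0" and u: "additive_fun u"
  shows "poly_iter ([:0, 1:] + u) CHAR('a) = [:0, 1:] + poly_iter u CHAR('a)"
proof -
  have p: "prime CHAR('a)" using char_pos prime_CHAR_semidom by blast
  have "poly_iter ([:0, 1:] + u) CHAR('a) =
      (\<Sum>i\<in>{0, CHAR('a)}. smult (of_nat (CHAR('a) choose i)) (poly_iter u i))"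
    unfolding poly_iter_id_plus[OF u]
  proof (intro sum.mono_neutral_right ballI)
    fix i assume "i \<in> {..CHAR('a)} - {0, CHAR('a)}"
    then have "CHAR('a) dvd (CHAR('a) choose i)"
      using char_pos p by (intro dvd_choose_prime) auto
    then show "smult (of_nat (CHAR('a) choose i)) (poly_iter u i) = 0"
      by (simp add: of_nat_eq_0_iff_char_dvd)
  qed auto
  then show ?thesis using char_pos by simp
qed

lemma poly_iter_id_plus_CHAR_power:
  fixes u :: "'a::alg_closed_field poly"
  assumes "CHAR('a) > 0" "additive_fun u"
  shows "poly_iter ([:0, 1:] + u) (CHAR('a) ^ e) = [:0, 1:] + poly_iter u (CHAR('a) ^ e)"
proof (induction e)
  case (Suc e)
  have "poly_iter ([:0, 1:] + u) (CHAR('a) ^ Suc e) = poly_iter (poly_iter ([:0, 1:] + u) (CHAR('a) ^ e)) CHAR('a)"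
    by (simp add: poly_iter_poly_iter mult.commute)
  also have "\<dots> = poly_iter ([:0, 1:] + poly_iter u (CHAR('a) ^ e)) CHAR('a)"
    by (simp only: Suc)
  also have "\<dots> = [:0, 1:] + poly_iter u (CHAR('a) ^ Suc e)"
    using assms by (subst poly_iter_id_plus_CHAR)
      (simp_all add: additive_fun_poly_iter poly_iter_poly_iter mult.commute)
  finally show ?case .
qed simp

lemma order_0_eqI:
  assumes "coeff P n \<noteq> 0" "\<And>i. i < n \<Longrightarrow> coeff P i = 0"
  shows "order 0 P = n"
proof -
  have nz: "P \<noteq> 0" using assms(1) by auto
  have "monom 1 n dvd P" using assms(2) by (simp add: monom_1_dvd_iff')
  moreover have "\<not> monom 1 (Suc n) dvd P" using assms(1) by (auto simp: monom_1_dvd_iff')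
  ultimately show ?thesis by (simp add: monom_1_dvd_iff nz)
qed

lemma coeff_order_0_neq_0: "P \<noteq> 0 \<Longrightarrow> coeff P (order 0 P) \<noteq> (0::'a::field)"
  and coeff_less_order_0: "P \<noteq> 0 \<Longrightarrow> i < order 0 P \<Longrightarrow> coeff P i = (0::'a::field)"
proof -
  assume nz: "P \<noteq> 0"
  have *: "monom 1 (order 0 P) dvd P" "\<not> monom 1 (Suc (order 0 P)) dvd P"
    by (simp_all add: monom_1_dvd_iff nz)
  then show "coeff P (order 0 P) \<noteq> 0" "i < order 0 P \<Longrightarrow> coeff P i = 0"
    unfolding monom_1_dvd_iff' by (auto simp: less_Suc_eq)
qed

text \<open>In the binomial expansion the term \<open>s u\<close> has the order \<open>W\<close> of
  \<open>u\<close>, as \<open>s\<close> is nonzero in the field, while the \<open>i\<close>-th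
  iterate of \<open>u\<close> with \<open>i \<ge> 2\<close> has order
  \<open>W ^ i > W\<close>.\<close>

lemma order_0_poly_iter_id_plus_minus_id_coprime:
  fixes u :: "'a::alg_closed_field poly"
  assumes u: "additive_fun u" "u \<noteq> 0" and order: "order 0 u \<ge> 2" and s: "\<not> CHAR('a) dvd s"
  shows "order 0 (poly_iter ([:0, 1:] + u) s - [:0, 1:]) = order 0 u"
proof -
  define W where "W = order 0 u"
  define E where "E = (\<Sum>i\<in>{2..s}. smult (of_nat (s choose i)) (poly_iter u i))"
  have deg: "degree u > 0" using degree_additive_fun_pos[OF u] .
  have "s > 0" using s by (intro gr0I) auto
  then have "{..s} = insert 0 (insert 1 {2..s})" by auto
  then have split: "poly_iter ([:0, 1:] + u) s - [:0, 1:] = smult (of_nat s) u + E"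
    by (simp add: poly_iter_id_plus[OF u(1)] E_def)
  have "coeff (poly_iter u i) j = 0" if "i \<ge> 2" "j \<le> W" for i j
  proof (rule coeff_less_order_0)
    show "poly_iter u i \<noteq> 0" using poly_iter_nonzero[OF deg] .
    have "W ^ 1 < W ^ i" using that(1) order by (intro power_strict_increasing) (auto simp: W_def)
    then show "j < order 0 (poly_iter u i)"
      using that(2) by (simp add: order_0_poly_iter deg additive_fun_0[OF u(1)] W_def)
  qed
  then have E: "coeff E j = 0" if "j \<le> W" for j
    using that by (simp add: E_def coeff_sum)
  have "of_nat s \<noteq> (0 :: 'a)" using s by (simp add: of_nat_eq_0_iff_char_dvd)
  then show ?thesis
    unfolding split W_def[symmetric]
    using E coeff_order_0_neq_0[OF u(2)] coeff_less_order_0[OF u(2)]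
    by (intro order_0_eqI) (auto simp: W_def)
qed

text \<open>Write \<open>s = p ^ v * t\<close> with \<open>t\<close> prime to \<open>p\<close>. The
  \<open>p ^ v\<close>-th iterate of \<open>1 + u\<close> is 1 plus the \<open>p ^ v\<close>-th
  iterate of \<open>u\<close>, whose order is \<open>W ^ (p ^ v)\<close>; iterating \<open>t\<close>
  more times preserves that order.\<close>

lemma order_0_poly_iter_id_plus_minus_id:
  fixes u :: "'a::alg_closed_field poly"
  assumes char: "CHAR('a) > 0" and u: "additive_fun u" "u \<noteq> 0" and order: "order 0 u \<ge> 2"
    and s: "s > 0"
  shows "order 0 (poly_iter ([:0, 1:] + u) s - [:0, 1:]) = order 0 u ^ (CHAR('a) ^ multiplicity CHAR('a) s)"
proof -
  let ?p = "CHAR('a)"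
  have "prime ?p" using char prime_CHAR_semidom by blast
  then obtain t where t: "s = ?p ^ multiplicity ?p s * t" "\<not> ?p dvd t"
    using multiplicity_decompose'[of s ?p] s by (metis neq0_conv not_prime_unit)
  define v where "v = poly_iter u (?p ^ multiplicity ?p s)"
  have deg: "degree u > 0" using degree_additive_fun_pos[OF u] .
  have v: "additive_fun v" "v \<noteq> 0" "order 0 v = order 0 u ^ (?p ^ multiplicity ?p s)"
    using u deg by (simp_all add: v_def additive_fun_poly_iter poly_iter_nonzero order_0_poly_iter additive_fun_0)
  have "order 0 u ^ 1 \<le> order 0 v"
    unfolding v(3) using order char by (intro power_increasing) auto
  then have "order 0 v \<ge> 2" using order by simp
  then have "order 0 (poly_iter ([:0, 1:] + v) t - [:0, 1:]) = order 0 v"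
    using v t(2) by (intro order_0_poly_iter_id_plus_minus_id_coprime)
  moreover have "poly_iter ([:0, 1:] + u) s = poly_iter ([:0, 1:] + v) t"
    by (subst t(1)) (simp add: v_def char u(1) poly_iter_id_plus_CHAR_power flip: poly_iter_poly_iter)
  ultimately show ?thesis using v(3) by simp
qed

section \<open>The dichotomy\<close>

text \<open>
  An additive polynomial commuting with the group of \<open>d\<close>-th roots of unity; \<open>d = 1\<close> covers
  the additive maps.
\<close>

locale equivariant_additive =
  fixes \<psi> :: "'a::alg_closed_field poly" and d :: nat
  assumes char_pos: "CHAR('a) > 0"
    and additive: "additive_fun \<psi>"
    and degree_ge_2: "degree \<psi> \<ge> 2"
    and coeff_1_nonzero: "coeff \<psi> 1 \<noteq> 0"
    and d_pos: "d > 0"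
    and card_roots_of_unity: "card {c::'a. c ^ d = 1} = d"
    and equivariant: "c ^ d = 1 \<Longrightarrow> poly \<psi> (c * x) = c * poly \<psi> x"
begin

abbreviation "roots_of_unity \<equiv> {c::'a. c ^ d = 1}"

abbreviation "iter_minus n c \<equiv> poly_iter \<psi> n - [:0, c:]"

lemma finite_roots_of_unity: "finite roots_of_unity"
  using card_roots_of_unity d_pos by (metis card.infinite less_irrefl)

lemma psi_0 [simp]: "poly \<psi> 0 = 0"
  using additive by (rule additive_fun_0)

lemma equivariant_poly_iter: "c ^ d = 1 \<Longrightarrow> poly (poly_iter \<psi> n) (c * x) = c * poly (poly_iter \<psi> n) x"
  by (induction n) (simp_all add: poly_iter_Suc poly_pcompose equivariant)

lemma additive_fun_iter_minus: "additive_fun (iter_minus n c)"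
  by (intro additive_fun_diff additive_fun_poly_iter additive additive_fun_linear)

lemma degree_iter_minus:
  assumes "n > 0"
  shows "degree (iter_minus n c) = degree \<psi> ^ n"
proof -
  have "degree \<psi> ^ 1 \<le> degree \<psi> ^ n" using assms degree_ge_2 by (intro power_increasing) auto
  then have "degree [:0, - c:] < degree (poly_iter \<psi> n)"
    using degree_ge_2 by (simp add: degree_poly_iter)
  then have "degree (poly_iter \<psi> n + [:0, - c:]) = degree \<psi> ^ n"
    by (simp add: degree_add_eq_left degree_poly_iter)
  moreover have "iter_minus n c = poly_iter \<psi> n + [:0, - c:]"
    by (rule poly_eqI) (simp add: coeff_pCons split: nat.split)
  ultimately show ?thesis by (simp only:)
qed

lemma iter_minus_nonzero: "n > 0 \<Longrightarrow> iter_minus n c \<noteq> 0"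
  using degree_iter_minus[of n c] degree_ge_2 by (metis degree_0 not_numeral_le_zero power_eq_0_iff)

lemma card_iter_minus_fiber:
  "n > 0 \<Longrightarrow> card {x. poly (iter_minus n c) x = y} * order 0 (iter_minus n c) = degree \<psi> ^ n"
  using card_additive_fun_fiber[OF additive_fun_iter_minus iter_minus_nonzero] by (simp add: degree_iter_minus)

lemma coeff_iter_minus:
  "coeff (iter_minus n c) 0 = 0" "coeff (iter_minus n c) 1 = coeff \<psi> 1 ^ n - c"
  using additive_fun_0[OF additive_fun_iter_minus[of n c]] coeff_1_poly_iter[OF psi_0, of n]
  by (simp_all add: poly_0_coeff_0)

lemma order_iter_minus_eq_1: "coeff \<psi> 1 ^ n \<noteq> c \<Longrightarrow> order 0 (iter_minus n c) = 1"
  by (rule order_0_eqI) (simp_all only: coeff_iter_minus less_one right_minus_eq not_False_eq_True)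

text \<open>Dividing the \<open>m\<close>-th iterate by its linear coefficient \<open>c\<close>
  turns it into the identity plus some \<open>u\<close> of order at least 2, and \<open>W\<close> is
  that order. Since \<open>c ^ d = 1\<close>, equivariance lets the scalars pass through the
  iterates of \<open>\<psi>\<close>.\<close>

lemma order_iter_minus_multiple:
  assumes "m > 0" "(coeff \<psi> 1 ^ m) ^ d = 1"
  obtains W where "W \<ge> 2"
    "\<And>s. s > 0 \<Longrightarrow> order 0 (iter_minus (m * s) (coeff \<psi> 1 ^ (m * s))) = W ^ (CHAR('a) ^ multiplicity CHAR('a) s)"
proof -
  define c where "c = coeff \<psi> 1 ^ m"
  have c: "c ^ d = 1" "c \<noteq> 0" using assms coeff_1_nonzero by (simp_all add: c_def)
  define u where "u = smult (inverse c) (iter_minus m c)"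
  have id_plus_u: "[:0, 1:] + u = smult (inverse c) (poly_iter \<psi> m)"
    using c(2) by (simp add: u_def smult_diff_right)
  have u: "additive_fun u" "u \<noteq> 0"
    using c(2) iter_minus_nonzero[OF assms(1), of c]
    by (simp_all add: u_def additive_fun_smult additive_fun_iter_minus)
  have "coeff u 0 = 0" "coeff u 1 = 0"
    unfolding u_def coeff_smult coeff_iter_minus by (simp_all add: c_def)
  then have "coeff u i = 0" if "i < 2" for i using that by (auto simp: less_2_cases_iff)
  then have "order 0 u \<ge> 2"
    using coeff_order_0_neq_0[OF u(2)] linorder_not_less by blast
  moreover have "order 0 (iter_minus (m * s) (coeff \<psi> 1 ^ (m * s))) =
      order 0 u ^ (CHAR('a) ^ multiplicity CHAR('a) s)" if "s > 0" for s
  proof -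
    have inv: "inverse c ^ d = 1" using c by (simp add: power_inverse)
    have "poly (poly_iter (smult (inverse c) (poly_iter \<psi> m)) s) x =
        inverse c ^ s * poly (poly_iter \<psi> (m * s)) x" for x
    proof (induction s)
      case (Suc s)
      have "(inverse c ^ s) ^ d = 1"
        using inv by (metis mult.commute power_mult power_one)
      moreover have "poly (poly_iter \<psi> (m * Suc s)) x = poly (poly_iter \<psi> m) (poly (poly_iter \<psi> (m * s)) x)"
        by (simp add: poly_poly_iter funpow_add)
      ultimately show ?case
        by (simp add: poly_iter_Suc poly_pcompose Suc equivariant_poly_iter)
    qed simp
    then have "poly_iter ([:0, 1:] + u) s = smult (inverse c ^ s) (poly_iter \<psi> (m * s))"
      unfolding id_plus_u by (intro poly_eqI_alg_closed) simp
    then have "poly_iter ([:0, 1:] + u) s - [:0, 1:] = smult (inverse c ^ s) (iter_minus (m * s) (c ^ s))"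
      using c(2) by (simp add: smult_diff_right flip: power_mult_distrib)
    then have "order 0 (iter_minus (m * s) (c ^ s)) = order 0 (poly_iter ([:0, 1:] + u) s - [:0, 1:])"
      using c(2) by (simp add: order_smult)
    also have "\<dots> = order 0 u ^ (CHAR('a) ^ multiplicity CHAR('a) s)"
      using char_pos u \<open>order 0 u \<ge> 2\<close> that by (rule order_0_poly_iter_id_plus_minus_id)
    finally show ?thesis by (simp add: c_def power_mult)
  qed
  ultimately show ?thesis by (rule that)
qed

text \<open>In the sum all orders are 1 except possibly at \<open>c = coeff \<psi> 1 ^ n\<close>,
  which is among the \<open>d\<close>-th roots of unity exactly if \<open>b ^ n = 1\<close>.\<close>

lemma zeta_dichotomy:
  assumes count: "\<And>n. n > 0 \<Longrightarrow> of_nat (card (Per f X n)) =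
      1 + of_nat (degree \<psi>) ^ n / of_nat d * (\<Sum>c\<in>roots_of_unity. 1 / rat_of_nat (order 0 (iter_minus n c)))"
    and b: "b = coeff \<psi> 1 ^ d"
  shows "(algebraic_over prime_field b \<longrightarrow>
            transcendental_over rational_functions (fps_to_fls (artin_mazur_zeta f X)))
       \<and> (transcendental_over prime_field b \<longrightarrow>
            fps_to_fls (artin_mazur_zeta f X) \<in> rational_functions)"
proof -
  let ?a = "coeff \<psi> 1" and ?p = "CHAR('a)" and ?D = "degree \<psi>"
  have b_nz: "b \<noteq> 0" using coeff_1_nonzero by (simp add: b)
  have power_b: "(?a ^ n) ^ d = b ^ n" for n
    unfolding b by (simp add: mult.commute flip: power_mult)
  have generic: "rat_of_nat (card (Per f X n)) = 1 + of_nat ?D ^ n" if "n > 0" "b ^ n \<noteq> 1" for n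
  proof -
    have "order 0 (iter_minus n c) = 1" if "c \<in> roots_of_unity" for c
      using that \<open>b ^ n \<noteq> 1\<close> power_b[of n] by (intro order_iter_minus_eq_1) auto
    then show ?thesis using count[OF that(1)] d_pos by (simp add: card_roots_of_unity)
  qed
  show ?thesis
  proof (cases "\<exists>n>0. b ^ n = 1")
    case False
    have "card (Per f X n) = 1 + ?D ^ n" if "n > 0" for n
    proof -
      have "rat_of_nat (card (Per f X n)) = of_nat (1 + ?D ^ n)"
        using generic[OF that] False that by (metis of_nat_1 of_nat_add of_nat_power)
      then show ?thesis by (simp only: of_nat_eq_iff)
    qed
    then have "fps_to_fls (artin_mazur_zeta f X) \<in> rational_functions"
      by (rule artin_mazur_zeta_rational)
    then show ?thesis
      using False algebraic_over_prime_field_iff[OF char_pos b_nz] by blast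
  next
    case True
    define m where "m = (LEAST n. n > 0 \<and> b ^ n = 1)"
    have m: "m > 0" "b ^ m = 1"
      using LeastI_ex[OF True] by (auto simp: m_def)
    have m_dvd_iff: "b ^ n = 1 \<longleftrightarrow> m dvd n" for n
    proof
      assume "b ^ n = 1"
      moreover have "b ^ n = (b ^ m) ^ (n div m) * b ^ (n mod m)"
        by (metis mult_div_mod_eq power_add power_mult)
      ultimately have "b ^ (n mod m) = 1" using m(2) by simp
      then have "\<not> n mod m > 0"
        using not_less_Least[of "n mod m" "\<lambda>n. n > 0 \<and> b ^ n = 1"] m(1) by (auto simp: m_def)
      then show "m dvd n" by auto
    qed (use m(2) in \<open>auto simp: power_mult\<close>)
    obtain W where W: "W \<ge> 2" "\<And>s. s > 0 \<Longrightarrow>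
        order 0 (iter_minus (m * s) (?a ^ (m * s))) = W ^ (?p ^ multiplicity ?p s)"
      using order_iter_minus_multiple[of m] m power_b by metis
    \<comment> \<open>The mean of the reciprocal orders over the \<open>d\<close> roots of unity,
      when one order is \<open>W ^ (p ^ e)\<close> and the other \<open>d - 1\<close> are 1. If all
      are 1, the mean is 1, the value passed below for \<open>n\<close> not divisible by
      \<open>m\<close>.\<close>
    define \<phi> where "\<phi> e = 1 + (1 / rat_of_nat (W ^ (?p ^ e)) - 1) / of_nat d" for e
    have p: "prime ?p" using char_pos prime_CHAR_semidom by blast
    have "transcendental_over rational_functions (fps_to_fls (artin_mazur_zeta f X))"
    proof (rule artin_mazur_zeta_transcendental[OF p m(1), of ?D \<phi> f X 1])
      show "?D > 0" using degree_ge_2 by simp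
    next
      fix e
      have "?p ^ e < ?p ^ Suc e" using prime_gt_1_nat[OF p] by simp
      then have "W ^ (?p ^ e) < W ^ (?p ^ Suc e)"
        using W(1) by (intro power_strict_increasing) auto
      then have "rat_of_nat (W ^ (?p ^ e)) \<noteq> of_nat (W ^ (?p ^ Suc e))"
        by (simp only: of_nat_eq_iff less_imp_neq not_False_eq_True)
      then show "\<phi> e \<noteq> \<phi> (Suc e)"
        using d_pos W(1) unfolding \<phi>_def by (simp del: of_nat_power power_Suc)
    next
      fix n :: nat assume n: "n > 0"
      show "rat_of_nat (card (Per f X n)) = 1 + of_nat ?D ^ n * multiplicity_sequence ?p m \<phi> 1 n"
      proof (cases "m dvd n")
        case True
        then obtain s where s: "n = m * s" by (elim dvdE)
        have root: "?a ^ n \<in> roots_of_unity" using True m_dvd_iff power_b by simp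
        have "(\<Sum>c\<in>roots_of_unity. 1 / rat_of_nat (order 0 (iter_minus n c))) =
            1 / of_nat (order 0 (iter_minus n (?a ^ n))) +
            (\<Sum>c\<in>roots_of_unity - {?a ^ n}. 1 / rat_of_nat (order 0 (iter_minus n c)))"
          using root finite_roots_of_unity by (rule sum.remove[rotated])
        also have "(\<Sum>c\<in>roots_of_unity - {?a ^ n}. 1 / rat_of_nat (order 0 (iter_minus n c))) =
            (\<Sum>c\<in>roots_of_unity - {?a ^ n}. 1)"
          by (intro sum.cong refl) (subst order_iter_minus_eq_1, auto)
        also have "\<dots> = of_nat d - 1"
          using root finite_roots_of_unity d_pos by (simp add: card_roots_of_unity of_nat_diff)
        also have "order 0 (iter_minus n (?a ^ n)) = W ^ (?p ^ multiplicity ?p s)"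
          unfolding s using n s by (intro W(2)) auto
        finally have sum: "(\<Sum>c\<in>roots_of_unity. 1 / rat_of_nat (order 0 (iter_minus n c))) =
            1 / rat_of_nat (W ^ (?p ^ multiplicity ?p s)) + (of_nat d - 1)" .
        show ?thesis
          unfolding count[OF n] sum
          using d_pos m(1) by (simp add: s multiplicity_sequence_def \<phi>_def field_simps)
      next
        case False
        then show ?thesis
          using generic[OF n] m_dvd_iff by (simp add: multiplicity_sequence_def)
      qed
    qed
    then show ?thesis
      using True algebraic_over_prime_field_iff[OF char_pos b_nz] by (simp add: transcendental_over_def)
  qed
qed

end

section \<open>Periodic points of additive maps\<close>

lemma card_Per_proj_map:
  assumes "degree f > 0" "finite {x. (poly f ^^ n) x = x}"
  shows "card (Per (proj_map f) UNIV n) = 1 + card {x. (poly f ^^ n) x = x}"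
proof -
  have fin: "(proj_map f ^^ n) (Finite x) = Finite ((poly f ^^ n) x)" for x
    by (induction n) simp_all
  have inf: "(proj_map f ^^ n) Infinity = Infinity"
    using assms(1) by (induction n) simp_all
  have "Per (proj_map f) UNIV n = insert Infinity (Finite ` {x. (poly f ^^ n) x = x})"
  proof (rule set_eqI)
    fix z show "z \<in> Per (proj_map f) UNIV n \<longleftrightarrow> z \<in> insert Infinity (Finite ` {x. (poly f ^^ n) x = x})"
      by (cases z) (auto simp: Per_def fin inf)
  qed
  moreover have "card (Finite ` {x. (poly f ^^ n) x = x}) = card {x. (poly f ^^ n) x = x}"
    by (rule card_image) (simp add: inj_on_def)
  moreover have "Infinity \<notin> Finite ` {x. (poly f ^^ n) x = x}" by auto
  ultimately show ?thesis using assms(2) by (simp only: card_insert_disjoint finite_imageI) simp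
qed

context equivariant_additive begin

lemma order_iter_minus_pos: "n > 0 \<Longrightarrow> order 0 (iter_minus n c) > 0"
  using additive_fun_0[OF additive_fun_iter_minus] iter_minus_nonzero by (simp add: order_gt_0_iff del: poly_diff)

lemma card_iter_minus_fiber_rat:
  "n > 0 \<Longrightarrow> rat_of_nat (card {x. poly (iter_minus n c) x = y}) = of_nat (degree \<psi>) ^ n / of_nat (order 0 (iter_minus n c))"
  using arg_cong[OF card_iter_minus_fiber[of n c y], of rat_of_nat] order_iter_minus_pos[of n c]
  by (simp add: field_simps)

end

lemma zeta_dichotomy_additive_poly_map:
  fixes f :: "'a::alg_closed_field poly"
  assumes char: "CHAR('a) > 0" and "separable f" and "additive_poly_map f"
  shows "(algebraic_over prime_field (poly (pderiv f) 0) \<longrightarrow>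
            transcendental_over rational_functions (fps_to_fls (artin_mazur_zeta (proj_map f) UNIV)))
       \<and> (transcendental_over prime_field (poly (pderiv f) 0) \<longrightarrow>
            fps_to_fls (artin_mazur_zeta (proj_map f) UNIV) \<in> rational_functions)"
proof -
  obtain \<sigma> c where \<sigma>: "additive_poly \<sigma>" "degree \<sigma> \<ge> 2" and f: "f = \<sigma> + [:c:]"
    using assms(3) by (auto simp: additive_poly_map_def)
  have add: "additive_fun \<sigma>" using additive_poly_imp_additive_fun[OF char \<sigma>(1)] .
  have deriv: "pderiv f = [:coeff \<sigma> 1:]"
    using pderiv_additive_fun[OF add] by (simp add: f pderiv_add pderiv_pCons)
  then have "coeff \<sigma> 1 \<noteq> 0" using assms(2) by (auto simp: separable_def)
  then interpret equivariant_additive \<sigma> 1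
    by unfold_locales (use char add \<sigma> in auto)
  have deg: "degree f > 0"
    unfolding f using \<sigma>(2) by (subst degree_add_eq_left) auto
  show ?thesis
  proof (rule zeta_dichotomy)
    fix n :: nat assume n: "n > 0"
    \<comment> \<open>Iterates of \<open>f\<close> are iterates of \<open>\<sigma>\<close> followed
      by a translation. Fixed points thus form a fiber of \<open>iter_minus n 1\<close>, and every
      fiber has the same size as the kernel.\<close>
    have split: "(poly f ^^ k) x = (poly \<sigma> ^^ k) x + (poly f ^^ k) 0" for k x
    proof (induction k)
      case (Suc k)
      show ?case
        using arg_cong[OF Suc, of "poly f"] by (simp add: f additive_funD[OF add] add.assoc)
    qed simp
    have "(poly f ^^ n) x = x \<longleftrightarrow> poly (iter_minus n 1) x = - (poly f ^^ n) 0" for x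
      unfolding split[of n x] poly_diff poly_poly_iter by (simp add: algebra_simps eq_neg_iff_add_eq_0)
    then have fixed_eq: "{x. (poly f ^^ n) x = x} = {x. poly (iter_minus n 1) x = - (poly f ^^ n) 0}"
      by blast
    have "degree \<sigma> ^ n > 0" using \<sigma>(2) by simp
    then have "finite {x. (poly f ^^ n) x = x}"
      unfolding fixed_eq using card_iter_minus_fiber[OF n] by (metis card.infinite less_irrefl mult_0)
    from card_Per_proj_map[OF deg this]
    have "rat_of_nat (card (Per (proj_map f) UNIV n)) = 1 + of_nat (degree \<sigma>) ^ n / of_nat (order 0 (iter_minus n 1))"
      unfolding fixed_eq by (simp only: of_nat_add of_nat_1 card_iter_minus_fiber_rat[OF n])
    then show "rat_of_nat (card (Per (proj_map f) UNIV n)) =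
        1 + of_nat (degree \<sigma>) ^ n / of_nat 1 * (\<Sum>c\<in>roots_of_unity. 1 / rat_of_nat (order 0 (iter_minus n c)))"
      by simp
  qed (simp add: deriv)
qed

section \<open>Periodic points of subadditive polynomials\<close>

lemma roots_of_unity_eq_powers:
  fixes \<omega> :: "'a::field"
  assumes "primitive_root_of_unity d \<omega>" "d > 0"
  shows "{c. c ^ d = 1} = (\<lambda>j. \<omega> ^ j) ` {..<d}" "card {c::'a. c ^ d = 1} = d"
proof -
  let ?G = "{c::'a. c ^ d = 1}"
  have \<omega>: "\<omega> ^ d = 1" "\<And>j. 0 < j \<Longrightarrow> j < d \<Longrightarrow> \<omega> ^ j \<noteq> 1"
    using assms(1) by (auto simp: primitive_root_of_unity_def)
  have nz: "\<omega> \<noteq> 0" using \<omega>(1) assms(2) by (auto simp: power_0_left)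
  have neq: "\<omega> ^ i \<noteq> \<omega> ^ j" if "i < j" "j < d" for i j
  proof
    assume "\<omega> ^ i = \<omega> ^ j"
    then have "\<omega> ^ i * \<omega> ^ (j - i) = \<omega> ^ i * 1"
      using that by (metis le_add_diff_inverse less_imp_le mult_1_right power_add)
    then have "\<omega> ^ (j - i) = 1" using nz by simp
    then show False using \<omega>(2)[of "j - i"] that by simp
  qed
  have "inj_on (\<lambda>j. \<omega> ^ j) {..<d}"
    by (rule linorder_inj_onI') (use neq in auto)
  then have card: "card ((\<lambda>j. \<omega> ^ j) ` {..<d}) = d" by (simp add: card_image)
  have sub: "(\<lambda>j. \<omega> ^ j) ` {..<d} \<subseteq> ?G"
    using \<omega>(1) by (auto simp flip: power_mult) (metis mult.commute power_mult power_one)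
  \<comment> \<open>The \<open>d\<close> distinct powers of \<open>\<omega>\<close> exhaust the
    roots of this polynomial of degree at most \<open>d\<close>.\<close>
  let ?P = "monom (1::'a) d - 1"
  have "coeff ?P d = 1" using assms(2) by (simp add: coeff_1)
  then have P: "?P \<noteq> 0" by (metis coeff_0 zero_neq_one)
  have G: "?G = {x. poly ?P x = 0}" by (simp add: poly_monom)
  have "degree ?P \<le> d" by (intro degree_diff_le) (simp_all add: degree_monom_le)
  then have "finite ?G" "card ?G \<le> d"
    unfolding G using poly_roots_finite[OF P] card_poly_roots_bound[OF P] by auto
  then show eq: "?G = (\<lambda>j. \<omega> ^ j) ` {..<d}" using sub card by (metis card_seteq)
  show "card ?G = d" unfolding eq by (rule card)
qed

context equivariant_additive begin

text \<open>
  A fixed point \<open>x\<^sup>d\<close> of \<open>f\<^sup>n\<close> lifts to a solution of \<open>\<psi>\<^sup>n(x) = c x\<close> with \<open>c\<^sup>d = 1\<close>;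
  away from 0 the lift determines \<open>c\<close>, and there are \<open>d\<close> lifts.
\<close>

lemma card_fixed_points_quotient:
  assumes f: "pcompose f (monom 1 d) = \<psi> ^ d" and n: "n > 0"
  shows "finite {y. (poly f ^^ n) y = y}"
    and "rat_of_nat (card {y. (poly f ^^ n) y = y}) =
      of_nat (degree \<psi>) ^ n / of_nat d * (\<Sum>c\<in>roots_of_unity. 1 / rat_of_nat (order 0 (iter_minus n c)))"
proof -
  let ?F = "{y. (poly f ^^ n) y = y}"
  let ?q = "poly (poly_iter \<psi> n)"
  define K where "K c = {x. ?q x = c * x}" for c
  define A where "A = (\<Union>c\<in>roots_of_unity. K c - {0})"
  have K_eq: "K c = {x. poly (iter_minus n c) x = 0}" for c
    by (auto simp: K_def mult.commute)
  have fin_K: "finite (K c)" for c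
    unfolding K_eq using iter_minus_nonzero[OF n] by (rule poly_roots_finite)
  have q_0: "?q 0 = 0"
    using additive_fun_0[OF additive_fun_poly_iter[OF additive]] .
  have fin_A: "finite A" unfolding A_def using fin_K finite_roots_of_unity by auto
  have "poly f (x ^ d) = poly \<psi> x ^ d" for x
    using arg_cong[OF f, of "\<lambda>p. poly p x"] by (simp add: poly_pcompose poly_monom)
  then have "(poly f ^^ k) (x ^ d) = (poly \<psi> ^^ k) x ^ d" for k x
    by (induction k) simp_all
  then have fixed_iff: "x ^ d \<in> ?F \<longleftrightarrow> ?q x ^ d = x ^ d" for x
    by (simp add: poly_poly_iter)
  have A_iff: "x \<in> A \<longleftrightarrow> x \<noteq> 0 \<and> x ^ d \<in> ?F" for x
  proof (cases "x = 0")
    case False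
    have "(\<exists>c. c ^ d = 1 \<and> ?q x = c * x) \<longleftrightarrow> ?q x ^ d = x ^ d"
    proof
      assume "?q x ^ d = x ^ d"
      then show "\<exists>c. c ^ d = 1 \<and> ?q x = c * x"
        using False by (intro exI[of _ "?q x / x"]) (simp add: power_divide)
    qed (auto simp: power_mult_distrib)
    then show ?thesis using False unfolding fixed_iff A_def K_def by auto
  qed (simp add: A_def)
  have image: "(\<lambda>x. x ^ d) ` A = ?F - {0}"
  proof (intro equalityI subsetI)
    fix y assume y: "y \<in> ?F - {0}"
    obtain x where "x ^ d = y" using nth_root_exists[OF d_pos, of y] by auto
    then show "y \<in> (\<lambda>x. x ^ d) ` A" using y d_pos by (intro image_eqI[of _ _ x]) (auto simp: A_iff)
  qed (auto simp: A_iff)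
  then have "finite (?F - {0})" using fin_A by (metis finite_imageI)
  then show fin_F: "finite ?F" by simp
  have "0 ^ d \<in> ?F" unfolding fixed_iff by (simp add: q_0)
  then have zero: "0 \<in> ?F" using d_pos by (simp add: power_0_left)
  have fiber: "card {x \<in> A. x ^ d = y} = d" if y: "y \<in> ?F - {0}" for y
  proof -
    obtain x0 where x0: "x0 ^ d = y" using nth_root_exists[OF d_pos, of y] by auto
    have nz: "x0 \<noteq> 0" using x0 y d_pos by (auto simp: power_0_left)
    have "{x \<in> A. x ^ d = y} = (\<lambda>c. c * x0) ` roots_of_unity"
    proof (intro equalityI subsetI)
      fix x assume "x \<in> {x \<in> A. x ^ d = y}"
      then show "x \<in> (\<lambda>c. c * x0) ` roots_of_unity"
        using nz x0 y by (intro image_eqI[of _ _ "x / x0"]) (auto simp: power_divide)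
    next
      fix x assume "x \<in> (\<lambda>c. c * x0) ` roots_of_unity"
      then have "x ^ d = y" "x \<noteq> 0" using x0 nz d_pos by (auto simp: power_mult_distrib power_0_left)
      then show "x \<in> {x \<in> A. x ^ d = y}" using y by (simp add: A_iff)
    qed
    moreover have "inj_on (\<lambda>c. c * x0) roots_of_unity" using nz by (auto simp: inj_on_def)
    ultimately show ?thesis by (simp add: card_image card_roots_of_unity)
  qed
  \<comment> \<open>\<open>A\<close> is counted in two ways: over the nonzero fixed points, with
    \<open>d\<close> lifts each, and over the \<open>c\<close>, where each \<open>K c\<close> loses
    only 0.\<close>
  have "card A = (\<Sum>y\<in>?F - {0}. card {x \<in> A. x ^ d = y})"
    using sum.group[of A "?F - {0}" "\<lambda>x. x ^ d" "\<lambda>_. 1::nat"] fin_A fin_F image by simp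
  also have "\<dots> = (card ?F - 1) * d"
    using fin_F zero by (simp add: fiber)
  finally have "rat_of_nat (card A) = (of_nat (card ?F) - 1) * of_nat d"
    using fin_F zero card_gt_0_iff[of ?F] by (auto simp: of_nat_diff)
  moreover have "rat_of_nat (card A) = (\<Sum>c\<in>roots_of_unity. of_nat (card (K c)) - 1)"
  proof -
    have "card A = (\<Sum>c\<in>roots_of_unity. card (K c - {0}))"
      unfolding A_def using finite_roots_of_unity fin_K
      by (intro card_UN_disjoint) (auto simp: K_def)
    also have "rat_of_nat \<dots> = (\<Sum>c\<in>roots_of_unity. of_nat (card (K c)) - 1)"
      unfolding of_nat_sum
    proof (intro sum.cong refl)
      fix c
      have "0 \<in> K c" using q_0 by (simp add: K_def)
      then show "rat_of_nat (card (K c - {0})) = of_nat (card (K c)) - 1"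
        using fin_K[of c] card_gt_0_iff[of "K c"] by (auto simp: of_nat_diff)
    qed
    finally show ?thesis .
  qed
  moreover have "rat_of_nat (card (K c)) = of_nat (degree \<psi>) ^ n * (1 / of_nat (order 0 (iter_minus n c)))" for c
    unfolding K_eq card_iter_minus_fiber_rat[OF n] by simp
  \<comment> \<open>The corrections cancel: the fixed point 0 is missing with weight
    \<open>d\<close> on the left, and 0 is missing from each of the \<open>d\<close> sets
    \<open>K c\<close> on the right.\<close>
  ultimately have "(of_nat (card ?F) - 1) * of_nat d =
      of_nat (degree \<psi>) ^ n * (\<Sum>c\<in>roots_of_unity. 1 / rat_of_nat (order 0 (iter_minus n c))) - of_nat d"
    by (simp add: sum_subtractf card_roots_of_unity sum_distrib_left)
  then show "rat_of_nat (card ?F) =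
      of_nat (degree \<psi>) ^ n / of_nat d * (\<Sum>c\<in>roots_of_unity. 1 / rat_of_nat (order 0 (iter_minus n c)))"
    using d_pos by (simp add: field_simps)
qed

end

text \<open>Differentiate \<open>f(x^d) = \<psi>(x)^d\<close>, write
  \<open>\<psi> = x \<rho>\<close> and use that the derivative of \<open>\<psi>\<close> is constant;
  then \<open>d x^(d-1)\<close> cancels because \<open>p\<close> does not divide \<open>d\<close>.
  The result shows that separability of \<open>f\<close> makes \<open>coeff \<psi> 1\<close>
  nonzero, and at 0 it gives \<open>f'(0) = coeff \<psi> 1 ^ d\<close>.\<close>

lemma pderiv_quotient_additive_fun:
  fixes f \<psi> :: "'a::alg_closed_field poly"
  assumes "additive_fun \<psi>" "\<not> CHAR('a) dvd d" "pcompose f (monom 1 d) = \<psi> ^ d"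
  obtains \<rho> where "poly \<rho> 0 = coeff \<psi> 1" "pcompose (pderiv f) (monom 1 d) = smult (coeff \<psi> 1) (\<rho> ^ (d - 1))"
proof -
  obtain \<rho> where \<rho>: "\<psi> = pCons 0 \<rho>"
    using additive_fun_0[OF assms(1)] by (metis pCons_cases poly_0_coeff_0 coeff_pCons_0)
  have \<psi>_pow: "\<psi> ^ (d - 1) = monom 1 (d - 1) * \<rho> ^ (d - 1)"
  proof -
    have "\<psi> = monom 1 1 * \<rho>" by (simp add: \<rho> monom_Suc)
    then show ?thesis by (simp add: power_mult_distrib monom_power)
  qed
  define M where "M = monom (1::'a) (d - 1)"
  have M: "pderiv (monom (1::'a) d) = smult (of_nat d) M"
    by (simp add: pderiv_monom M_def smult_monom)
  have "pcompose (pderiv f) (monom 1 d) * pderiv (monom 1 d) = smult (of_nat d) (\<psi> ^ (d - 1)) * pderiv \<psi>"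
    using arg_cong[OF assms(3), of pderiv] by (simp add: pderiv_pcompose pderiv_power)
  also have "\<dots> = smult (of_nat d) M * smult (coeff \<psi> 1) (\<rho> ^ (d - 1))"
    unfolding \<psi>_pow pderiv_additive_fun[OF assms(1)] M_def by simp
  finally have "smult (of_nat d) M * pcompose (pderiv f) (monom 1 d) =
      smult (of_nat d) M * smult (coeff \<psi> 1) (\<rho> ^ (d - 1))"
    by (simp only: M mult.commute[of "pcompose _ _"])
  moreover have "smult (of_nat d) M \<noteq> 0"
    using assms(2) by (simp add: M_def of_nat_eq_0_iff_char_dvd monom_eq_0_iff)
  ultimately have "pcompose (pderiv f) (monom 1 d) = smult (coeff \<psi> 1) (\<rho> ^ (d - 1))"
    by (simp only: mult_cancel_left) simp
  then show ?thesis using that[of \<rho>] by (simp add: \<rho> poly_0_coeff_0)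
qed

lemma zeta_dichotomy_subadditive_poly:
  fixes f :: "'a::alg_closed_field poly"
  assumes char: "CHAR('a) > 0" and "separable f" and "subadditive_poly f"
  shows "(algebraic_over prime_field (poly (pderiv f) 0) \<longrightarrow>
            transcendental_over rational_functions (fps_to_fls (artin_mazur_zeta (proj_map f) UNIV)))
       \<and> (transcendental_over prime_field (poly (pderiv f) 0) \<longrightarrow>
            fps_to_fls (artin_mazur_zeta (proj_map f) UNIV) \<in> rational_functions)"
proof -
  obtain d \<psi> \<omega> where d: "d \<ge> 2" "\<not> CHAR('a) dvd d"
    and \<psi>: "additive_poly \<psi>" "degree \<psi> \<ge> 2"
    and \<omega>: "primitive_root_of_unity d \<omega>" "pcompose \<psi> [:0, \<omega>:] = smult \<omega> \<psi>"
    and f: "pcompose f (monom 1 d) = \<psi> ^ d"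
    using assms(3) by (auto simp: subadditive_poly_def)
  have d_pos: "d > 0" using d(1) by simp
  have add: "additive_fun \<psi>" using additive_poly_imp_additive_fun[OF char \<psi>(1)] .
  obtain \<rho> where \<rho>: "poly \<rho> 0 = coeff \<psi> 1"
      "pcompose (pderiv f) (monom 1 d) = smult (coeff \<psi> 1) (\<rho> ^ (d - 1))"
    using pderiv_quotient_additive_fun[OF add d(2) f] by metis
  have coeff_1: "coeff \<psi> 1 \<noteq> 0"
  proof
    assume "coeff \<psi> 1 = 0"
    then have "pcompose (pderiv f) (monom 1 d) = 0" using \<rho>(2) by simp
    then have "pderiv f = 0"
      using pcompose_eq_0[of "pderiv f" "monom 1 d"] d_pos by (simp add: degree_monom_eq)
    then show False using assms(2) by (simp add: separable_def)
  qed
  have equivariant: "poly \<psi> (c * x) = c * poly \<psi> x" if "c ^ d = 1" for c x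
  proof -
    have omega: "poly \<psi> (\<omega> * y) = \<omega> * poly \<psi> y" for y
      using arg_cong[OF \<omega>(2), of "\<lambda>p. poly p y"] by (simp add: poly_pcompose mult.commute)
    have "c \<in> (\<lambda>j. \<omega> ^ j) ` {..<d}"
      using that unfolding roots_of_unity_eq_powers(1)[OF \<omega>(1) d_pos, symmetric] by simp
    then obtain j where "c = \<omega> ^ j" by blast
    moreover have "poly \<psi> (\<omega> ^ j * x) = \<omega> ^ j * poly \<psi> x"
      by (induction j) (simp_all add: omega mult.assoc)
    ultimately show ?thesis by simp
  qed
  interpret equivariant_additive \<psi> d
    by (rule equivariant_additive.intro[OF char add \<psi>(2) coeff_1 d_pos
        roots_of_unity_eq_powers(2)[OF \<omega>(1) d_pos] equivariant])
  have "\<psi> \<noteq> 0" using \<psi>(2) by auto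
  then have "degree f * d = degree \<psi> * d"
    using arg_cong[OF f, of degree] by (simp add: degree_pcompose degree_monom_eq degree_power_eq mult.commute)
  then have deg: "degree f > 0" using \<psi>(2) d_pos by simp
  have "poly (pderiv f) 0 = coeff \<psi> 1 * coeff \<psi> 1 ^ (d - 1)"
    using arg_cong[OF \<rho>(2), of "\<lambda>p. poly p 0"] d_pos \<rho>(1)
    by (simp add: poly_pcompose poly_monom power_0_left)
  then have deriv: "poly (pderiv f) 0 = coeff \<psi> 1 ^ d"
    using power_minus_mult[OF d_pos, of "coeff \<psi> 1"] by (simp only: mult.commute)
  show ?thesis
  proof (rule zeta_dichotomy[OF _ deriv])
    fix n :: nat assume n: "n > 0"
    show "rat_of_nat (card (Per (proj_map f) UNIV n)) = 1 + of_nat (degree \<psi>) ^ n / of_nat d *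
        (\<Sum>c\<in>roots_of_unity. 1 / rat_of_nat (order 0 (iter_minus n c)))"
      unfolding card_Per_proj_map[OF deg card_fixed_points_quotient(1)[OF f n]] of_nat_add
        card_fixed_points_quotient(2)[OF f n] by simp
  qed
qed

theorem theorem1p3:
  fixes f :: "'a::alg_closed_field poly"
  assumes "CHAR('a) > 0"
    and "separable f"
    and "additive_poly_map f \<or> subadditive_poly f"
  shows "(algebraic_over prime_field (poly (pderiv f) 0) \<longrightarrow>
            transcendental_over rational_functions
              (fps_to_fls (artin_mazur_zeta (proj_map f) UNIV)))
       \<and> (transcendental_over prime_field (poly (pderiv f) 0) \<longrightarrow>
            fps_to_fls (artin_mazur_zeta (proj_map f) UNIV) \<in> rational_functions)"
  using assms zeta_dichotomy_additive_poly_map zeta_dichotomy_subadditive_poly by blast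

end
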